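(* Let $\mathcal{H}_1,\mathcal{H}_2$ be complex separable Hilbert spaces and let $A:\operatorname{dom}(A)\subseteq\mathcal{H}_1\to\mathcal{H}_2$ be a densely defined, closed, linear operator with $A^*A\geq\varepsilon I_{\mathcal{H}_1}$ for some $\varepsilon>0$. Then $$Q_{A,0}\,[I_{\mathcal{H}_1\oplus\mathcal{H}_2}-P_{\ker(Q_{A,0})}]=U_{\widetilde A}\,i\,G_{A,0}\,U_{\widetilde A}^{-1},$$ where the left-hand side is regarded as an operator in $\mathcal{H}_1\oplus\mathcal{K}_A$ (equality including domains). In particular, the operator $i\,G_{A,0}$ is self-adjoint in $\mathcal{H}_A\oplus\mathcal{H}_1$, and hence $G_{A,0}$ generates a unitary group $e^{G_{A,0}t}$, $t\in\mathbb{R}$, in $\mathcal{H}_A\oplus\mathcal{H}_1$. Moreover, $G_{A,0}$ is unitarily equivalent to $-G_{A,0}$.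
   Context: $P_{\mathcal{M}}$ denotes the orthogonal projection onto a closed subspace $\mathcal{M}$. Under the hypothesis $A^*A\ge\varepsilon I_{\mathcal{H}_1}$: - $\mathcal{H}_A$ is the Hilbert space $\operatorname{dom}(A)$ with scalar product $(f,g)_A=(Af,Ag)_{\mathcal{H}_2}$. - $\mathcal{K}_A=\operatorname{ran}(A)$, which is a closed subspace of $\mathcal{H}_2$ equal to $\ker(A^* )^\perp$. - $\widetilde A:\mathcal{H}_A\to\mathcal{K}_A$, $f\mapsto Af$, a unitary operator. - $J_A:\mathcal{H}_1\supseteq\operatorname{dom}(A)\to\mathcal{H}_A$, $f\mapsto f$ (an in general unbounded operator from $\mathcal{H}_1$ to $\mathcal{H}_A$). - $U_{\widetilde A}=\begin{pmatrix}0&I_{\mathcal{H}_1}\\-i\widetilde A&0\end{pmatrix}:\mathcal{H}_A\oplus\mathcal{H}_1\to\mathcal{H}_1\oplus\mathcal{K}_A$, a unitary operator. - $G_{A,0}=\begin{pmatrix}0&J_A\\-A^*\widetilde A&0\end{pmatrix}$ in $\mathcal{H}_A\oplus\mathcal{H}_1$ with $\operatorname{dom}(G_{A,0})=\operatorname{dom}(A^*\widetilde A)\oplus\operatorname{dom}(A)$, where $\operatorname{dom}(A^*\widetilde A)=\{f\in\mathcal{H}_A : \widetilde Af\in\operatorname{dom}(A^* )\}$. - $Q_{A,0}=\begin{pmatrix}0&A^*\\ A&0\end{pmatrix}$ in $\mathcal{H}_1\oplus\mathcal{H}_2$ with $\operatorname{dom}(Q_{A,0})=\operatorname{dom}(A)\oplus\operatorname{dom}(A^*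 )$; it is self-adjoint, and $\ker(Q_{A,0})=\{0\}\oplus\ker(A^* )$. The subspace $\mathcal{H}_1\oplus\mathcal{K}_A=\ker(Q_{A,0})^\perp$ reduces $Q_{A,0}$; the operator $Q_{A,0}[I-P_{\ker(Q_{A,0})}]$ regarded in $\mathcal{H}_1\oplus\mathcal{K}_A$ is the part of $Q_{A,0}$ there, i.e. $(f,g)\mapsto(A^*g,Af)$ on $\operatorname{dom}(A)\oplus(\operatorname{dom}(A^* )\cap\mathcal{K}_A)$. *)

theory Defs
  imports "HOL-Analysis.Analysis"
begin

text \<open>
  A complex Hilbert space is a linear subspace of an ambient complex vector space type together
  with an inner product on that subspace. This makes it possible to put different inner products
  on subspaces of the same type, such as the domain of an operator.
  An unbounded operator is a partial function (\<open>map\<close>), so equality of operators includes equality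
  of their domains, and \<open>T \<circ>\<^sub>m S\<close> is the product with its natural domain.
\<close>

subsection \<open>Complex vector spaces\<close>

class complex_vector = ab_group_add +
  fixes scaleC :: "complex \<Rightarrow> 'a \<Rightarrow> 'a" (infixr "*\<^sub>C" 75)
  assumes scaleC_add_right: "a *\<^sub>C (x + y) = a *\<^sub>C x + a *\<^sub>C y"
    and scaleC_add_left: "(a + b) *\<^sub>C x = a *\<^sub>C x + b *\<^sub>C x"
    and scaleC_scaleC: "a *\<^sub>C b *\<^sub>C x = (a * b) *\<^sub>C x"
    and scaleC_one: "1 *\<^sub>C x = x"

global_interpretation complex_vector: vector_space "scaleC :: complex \<Rightarrow> 'a \<Rightarrow> 'a::complex_vector"
  by unfold_locales (simp_all add: scaleC_add_right scaleC_add_left scaleC_scaleC scaleC_one)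

instantiation prod :: (complex_vector, complex_vector) complex_vector
begin

definition scaleC_prod_def: "a *\<^sub>C p = (a *\<^sub>C fst p, a *\<^sub>C snd p)"

instance
  by standard
    (simp_all add: scaleC_prod_def scaleC_add_right scaleC_add_left scaleC_scaleC scaleC_one)

end

subsection \<open>Hilbert spaces\<close>

record 'a hspace =
  carrier :: "'a set"
  ip :: "'a \<Rightarrow> 'a \<Rightarrow> complex"

definition hnorm :: "'a hspace \<Rightarrow> 'a \<Rightarrow> real"
  where "hnorm H x = sqrt (Re (ip H x x))"

definition hconverges :: "'a::complex_vector hspace \<Rightarrow> (nat \<Rightarrow> 'a) \<Rightarrow> 'a \<Rightarrow> bool"
  where "hconverges H s x \<longleftrightarrow> (\<lambda>n. hnorm H (s n - x)) \<longlonglongrightarrow> 0"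

definition hCauchy :: "'a::complex_vector hspace \<Rightarrow> (nat \<Rightarrow> 'a) \<Rightarrow> bool"
  where "hCauchy H s \<longleftrightarrow> (\<forall>e>0. \<exists>N. \<forall>m\<ge>N. \<forall>n\<ge>N. hnorm H (s m - s n) < e)"

text \<open>Inner products are linear in the second and antilinear in the first argument.\<close>

definition inner_product_space :: "'a::complex_vector hspace \<Rightarrow> bool"
  where "inner_product_space H \<longleftrightarrow>
    complex_vector.subspace (carrier H) \<and>
    (\<forall>x\<in>carrier H. \<forall>y\<in>carrier H. ip H y x = cnj (ip H x y)) \<and>
    (\<forall>x\<in>carrier H. \<forall>y\<in>carrier H. \<forall>z\<in>carrier H. ip H x (y + z) = ip H x y + ip H x z) \<and>
    (\<forall>x\<in>carrier H. \<forall>y\<in>carrier H. \<forall>c. ip H x (c *\<^sub>C y) = c * ip H x y) \<and>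
    (\<forall>x\<in>carrier H. x \<noteq> 0 \<longrightarrow> 0 < Re (ip H x x))"

definition hilbert_space :: "'a::complex_vector hspace \<Rightarrow> bool"
  where "hilbert_space H \<longleftrightarrow> inner_product_space H \<and>
    (\<forall>s. range s \<subseteq> carrier H \<and> hCauchy H s \<longrightarrow> (\<exists>x\<in>carrier H. hconverges H s x))"

definition dense_in :: "'a::complex_vector hspace \<Rightarrow> 'a set \<Rightarrow> bool"
  where "dense_in H S \<longleftrightarrow>
    S \<subseteq> carrier H \<and> (\<forall>x\<in>carrier H. \<forall>e>0. \<exists>y\<in>S. hnorm H (x - y) < e)"

definition separable_hspace :: "'a::complex_vector hspace \<Rightarrow> bool"
  where "separable_hspace H \<longleftrightarrow> (\<exists>S. countable S \<and> dense_in H S)"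

definition direct_sum :: "'a hspace \<Rightarrow> 'b hspace \<Rightarrow> ('a \<times> 'b) hspace" (infixr "\<oplus>\<^sub>H" 65)
  where "H \<oplus>\<^sub>H K =
    \<lparr>carrier = carrier H \<times> carrier K,
     ip = (\<lambda>p q. ip H (fst p) (fst q) + ip K (snd p) (snd q))\<rparr>"

subsection \<open>Operators\<close>

text \<open>The partial function with graph \<open>R\<close>, wherever \<open>R\<close> is single-valued.\<close>

definition op_graph :: "('a \<Rightarrow> 'b \<Rightarrow> bool) \<Rightarrow> ('a \<rightharpoonup> 'b)"
  where "op_graph R x = (if \<exists>!y. R x y then Some (THE y. R x y) else None)"

definition linear_op ::
    "'a::complex_vector hspace \<Rightarrow> 'b::complex_vector hspace \<Rightarrow> ('a \<rightharpoonup> 'b) \<Rightarrow> bool"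
  where "linear_op H K T \<longleftrightarrow> hilbert_space H \<and> hilbert_space K \<and>
    complex_vector.subspace (dom T) \<and> dom T \<subseteq> carrier H \<and> ran T \<subseteq> carrier K \<and>
    (\<forall>f\<in>dom T. \<forall>g\<in>dom T. the (T (f + g)) = the (T f) + the (T g)) \<and>
    (\<forall>f\<in>dom T. \<forall>c. the (T (c *\<^sub>C f)) = c *\<^sub>C the (T f))"

definition densely_defined :: "'a::complex_vector hspace \<Rightarrow> ('a \<rightharpoonup> 'b) \<Rightarrow> bool"
  where "densely_defined H T \<longleftrightarrow> dense_in H (dom T)"

definition closed_op ::
    "'a::complex_vector hspace \<Rightarrow> 'b::complex_vector hspace \<Rightarrow> ('a \<rightharpoonup> 'b) \<Rightarrow> bool"
  where "closed_op H K T \<longleftrightarrow>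
    (\<forall>s x y. range s \<subseteq> dom T \<and> x \<in> carrier H \<and> y \<in> carrier K \<and>
       hconverges H s x \<and> hconverges K (\<lambda>n. the (T (s n))) y \<longrightarrow> T x = Some y)"

definition adj_op ::
    "'a hspace \<Rightarrow> 'b hspace \<Rightarrow> ('a \<rightharpoonup> 'b) \<Rightarrow> ('b \<rightharpoonup> 'a)"
  where "adj_op H K T =
    op_graph (\<lambda>g h. g \<in> carrier K \<and> h \<in> carrier H \<and>
      (\<forall>f\<in>dom T. ip K (the (T f)) g = ip H f h))"

definition selfadjoint :: "'a::complex_vector hspace \<Rightarrow> ('a \<rightharpoonup> 'a) \<Rightarrow> bool"
  where "selfadjoint H T \<longleftrightarrow> linear_op H H T \<and> densely_defined H T \<and> adj_op H H T = T"

text \<open>\<open>T \<ge> \<epsilon> I\<close> in the sense of quadratic forms on the domain of \<open>T\<close>.\<close>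

definition op_ge :: "'a hspace \<Rightarrow> ('a \<rightharpoonup> 'a) \<Rightarrow> real \<Rightarrow> bool"
  where "op_ge H T \<epsilon> \<longleftrightarrow>
    (\<forall>f\<in>dom T. ip H f (the (T f)) \<in> \<real> \<and> \<epsilon> * (hnorm H f)\<^sup>2 \<le> Re (ip H f (the (T f))))"

definition id_op :: "'a set \<Rightarrow> ('a \<rightharpoonup> 'a)"
  where "id_op S = Some |` S"

definition zero_op :: "'a set \<Rightarrow> ('a \<rightharpoonup> 'b::zero)"
  where "zero_op S = (\<lambda>_. Some 0) |` S"

definition scale_op :: "complex \<Rightarrow> ('a \<rightharpoonup> 'b::complex_vector) \<Rightarrow> ('a \<rightharpoonup> 'b)" (infixr "*\<^sub>O" 75)
  where "c *\<^sub>O T = (\<lambda>f. map_option ((*\<^sub>C) c) (T f))"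

definition diff_op :: "('a \<rightharpoonup> 'b::minus) \<Rightarrow> ('a \<rightharpoonup> 'b) \<Rightarrow> ('a \<rightharpoonup> 'b)" (infixl "-\<^sub>O" 65)
  where "S -\<^sub>O T =
    (\<lambda>f. if f \<in> dom S \<inter> dom T then Some (the (S f) - the (T f)) else None)"

definition inv_op :: "('a \<rightharpoonup> 'b) \<Rightarrow> ('b \<rightharpoonup> 'a)"
  where "inv_op T = op_graph (\<lambda>y x. T x = Some y)"

definition ker_op :: "('a \<rightharpoonup> 'b::zero) \<Rightarrow> 'a set"
  where "ker_op T = {f. T f = Some 0}"

definition orth_proj :: "'a::complex_vector hspace \<Rightarrow> 'a set \<Rightarrow> ('a \<rightharpoonup> 'a)"
  where "orth_proj H M =
    op_graph (\<lambda>x y. x \<in> carrier H \<and> y \<in> M \<and> (\<forall>z\<in>M. ip H z (x - y) = 0))"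

text \<open>The operator matrix with rows \<open>(T11, T12)\<close> and \<open>(T21, T22)\<close>, on its natural domain.\<close>

definition block_op ::
    "('a \<rightharpoonup> 'c::plus) \<Rightarrow> ('b \<rightharpoonup> 'c) \<Rightarrow> ('a \<rightharpoonup> 'd::plus) \<Rightarrow> ('b \<rightharpoonup> 'd) \<Rightarrow> ('a \<times> 'b \<rightharpoonup> 'c \<times> 'd)"
  where "block_op T11 T12 T21 T22 =
    (\<lambda>(f, g).
       if f \<in> dom T11 \<inter> dom T21 \<and> g \<in> dom T12 \<inter> dom T22
       then Some (the (T11 f) + the (T12 g), the (T21 f) + the (T22 g))
       else None)"

definition unitary ::
    "'a::complex_vector hspace \<Rightarrow> 'b::complex_vector hspace \<Rightarrow> ('a \<rightharpoonup> 'b) \<Rightarrow> bool"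
  where "unitary H K U \<longleftrightarrow> linear_op H K U \<and> dom U = carrier H \<and> ran U = carrier K \<and>
    (\<forall>f\<in>carrier H. \<forall>g\<in>carrier H. ip K (the (U f)) (the (U g)) = ip H f g)"

definition unitarily_equivalent ::
    "'a::complex_vector hspace \<Rightarrow> ('a \<rightharpoonup> 'a) \<Rightarrow> 'b::complex_vector hspace \<Rightarrow> ('b \<rightharpoonup> 'b) \<Rightarrow> bool"
  where "unitarily_equivalent H T K S \<longleftrightarrow>
    (\<exists>V. unitary H K V \<and> S = V \<circ>\<^sub>m T \<circ>\<^sub>m inv_op V)"

subsection \<open>Unitary groups\<close>

definition unitary_group :: "'a::complex_vector hspace \<Rightarrow> (real \<Rightarrow> ('a \<rightharpoonup> 'a)) \<Rightarrow> bool"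
  where "unitary_group H W \<longleftrightarrow>
    (\<forall>t. unitary H H (W t)) \<and>
    W 0 = id_op (carrier H) \<and>
    (\<forall>s t. W (s + t) = W s \<circ>\<^sub>m W t) \<and>
    (\<forall>x\<in>carrier H. \<forall>t\<^sub>0. ((\<lambda>t. hnorm H (the (W t x) - the (W t\<^sub>0 x))) \<longlongrightarrow> 0) (at t\<^sub>0))"

definition generator :: "'a::complex_vector hspace \<Rightarrow> (real \<Rightarrow> ('a \<rightharpoonup> 'a)) \<Rightarrow> ('a \<rightharpoonup> 'a)"
  where "generator H W =
    op_graph (\<lambda>x y. x \<in> carrier H \<and> y \<in> carrier H \<and>
      ((\<lambda>t. hnorm H (complex_of_real (1 / t) *\<^sub>C (the (W t x) - x) - y)) \<longlongrightarrow> 0) (at 0))"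

definition generates_unitary_group :: "'a::complex_vector hspace \<Rightarrow> ('a \<rightharpoonup> 'a) \<Rightarrow> bool"
  where "generates_unitary_group H G \<longleftrightarrow> (\<exists>W. unitary_group H W \<and> generator H W = G)"

subsection \<open>The spaces and operators associated with \<open>A\<close>\<close>

definition HA :: "'b hspace \<Rightarrow> ('a \<rightharpoonup> 'b) \<Rightarrow> 'a hspace"
  where "HA H2 A = \<lparr>carrier = dom A, ip = (\<lambda>f g. ip H2 (the (A f)) (the (A g)))\<rparr>"

definition KA :: "'b hspace \<Rightarrow> ('a \<rightharpoonup> 'b) \<Rightarrow> 'b hspace"
  where "KA H2 A = \<lparr>carrier = ran A, ip = ip H2\<rparr>"

text \<open>
  As partial functions, \<open>A_tilde A\<close> is \<open>A\<close> and \<open>JA A\<close> is the identity on \<open>dom A\<close>; what changes is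
  that they are regarded as operators from \<open>HA\<close> to \<open>KA\<close> and from \<open>H1\<close> to \<open>HA\<close>.
\<close>

definition A_tilde :: "('a \<rightharpoonup> 'b) \<Rightarrow> ('a \<rightharpoonup> 'b)"
  where "A_tilde A = A"

definition JA :: "('a \<rightharpoonup> 'b) \<Rightarrow> ('a \<rightharpoonup> 'a)"
  where "JA A = id_op (dom A)"

definition U_tilde ::
    "'a::complex_vector hspace \<Rightarrow> 'b::complex_vector hspace \<Rightarrow> ('a \<rightharpoonup> 'b) \<Rightarrow> ('a \<times> 'a \<rightharpoonup> 'a \<times> 'b)"
  where "U_tilde H1 H2 A =
    block_op (zero_op (carrier (HA H2 A))) (id_op (carrier H1))
             ((- \<i>) *\<^sub>O A_tilde A)         (zero_op (carrier H1))"

definition GA0 ::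
    "'a::complex_vector hspace \<Rightarrow> 'b::complex_vector hspace \<Rightarrow> ('a \<rightharpoonup> 'b) \<Rightarrow> ('a \<times> 'a \<rightharpoonup> 'a \<times> 'a)"
  where "GA0 H1 H2 A =
    block_op (zero_op (carrier (HA H2 A)))                      (JA A)
             ((- 1) *\<^sub>O (adj_op H1 H2 A \<circ>\<^sub>m A_tilde A)) (zero_op (carrier H1))"

definition QA0 ::
    "'a::complex_vector hspace \<Rightarrow> 'b::complex_vector hspace \<Rightarrow> ('a \<rightharpoonup> 'b) \<Rightarrow> ('a \<times> 'b \<rightharpoonup> 'a \<times> 'b)"
  where "QA0 H1 H2 A =
    block_op (zero_op (carrier H1)) (adj_op H1 H2 A)
             A                      (zero_op (carrier H2))"

end

theory Submission
  imports Defs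
begin

text \<open>
  Solving \<open>f + c\<^sup>2 A\<^sup>* A f = u\<close> by projecting \<open>(u, 0)\<close> onto the graph of \<open>c A\<close> shows that the lower
  bound on \<open>A\<^sup>* A\<close> extends to \<open>\<parallel>A f\<parallel>\<^sup>2 \<ge> \<epsilon> \<parallel>f\<parallel>\<^sup>2\<close> on all of \<open>dom A\<close> and that \<open>ran (A\<^sup>* A)\<close> has trivial
  orthogonal complement. The first fact makes \<open>HA\<close> complete, the second one makes the symmetric
  operator \<open>\<i> G\<close> self-adjoint. The unitary group is obtained, without spectral theory or
  exponentials of bounded operators, from the implicit Euler scheme: on \<open>dom (G\<^sup>2)\<close>, the contractions
  \<open>E h = (1 - h G)\<^sup>-\<^sup>1\<close> satisfy \<open>\<parallel>E (s + t) x - E s (E t x)\<parallel> \<le> 2 (\<bar>s\<bar> + \<bar>t\<bar>)\<^sup>2 \<parallel>G\<^sup>2 x\<parallel>\<close>, so their iterates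
  \<open>E (t / 2\<^sup>k)\<close>, applied \<open>2\<^sup>k\<close> times, form a Cauchy sequence whose limit inherits the group law.
  Finally, \<open>diag (1, -1)\<close> conjugates \<open>G\<close> to \<open>- G\<close>.
\<close>

subsection \<open>Inner product spaces on a carrier\<close>

text \<open>The lower bound is assumed only on \<open>dom (A\<^sup>* A)\<close>, whereas
  \<open>HA\<close> lives on all of \<open>dom A\<close>; completeness of \<open>HA\<close> depends
  on closing this gap. Self-adjointness of \<open>\<i> G\<close> is read off from the adjoint
  itself, not transported from \<open>Q\<close>. Testing the adjoint relation at
  \<open>(p, q)\<close> with vectors \<open>(0, g)\<close> says that \<open>A p\<close> lies in the
  domain of the adjoint of \<open>A\<close>. Testing with \<open>(f, 0)\<close> yields an identity
  in \<open>H1\<close> against vectors of \<open>ran (A\<^sup>* A)\<close> only; the trivial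
  orthogonal complement turns it into \<open>q \<in> dom A\<close>. \<open>G\<close> is in general
  unbounded, so no exponential series is at hand. Euler steps are contractions because the cross
  term in \<open>\<parallel>x - h G x\<parallel>\<^sup>2\<close> vanishes, for \<open>h\<close> of
  either sign. Contractions do not amplify errors, so \<open>2\<^sup>k\<close> local errors of order
  \<open>4\<^sup>-\<^sup>k\<close> add up to order \<open>2\<^sup>-\<^sup>k\<close>. The estimates
  live on \<open>dom (G\<^sup>2)\<close>; its density carries convergence and the group law to the
  whole space, and approximation of \<open>G x\<close> by values of \<open>G\<close> on
  \<open>dom (G\<^sup>2)\<close> carries the derivative to \<open>dom G\<close>.\<close>

locale ips =
  fixes H :: "'a::complex_vector hspace"
  assumes ips: "inner_product_space H"
begin

lemma subspace_carrier: "complex_vector.subspace (carrier H)"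
  using ips by (simp add: inner_product_space_def)

lemma carrier_zero [simp]: "0 \<in> carrier H"
  and carrier_add [simp]: "x \<in> carrier H \<Longrightarrow> y \<in> carrier H \<Longrightarrow> x + y \<in> carrier H"
  and carrier_diff [simp]: "x \<in> carrier H \<Longrightarrow> y \<in> carrier H \<Longrightarrow> x - y \<in> carrier H"
  and carrier_scale [simp]: "x \<in> carrier H \<Longrightarrow> c *\<^sub>C x \<in> carrier H"
  and carrier_minus [simp]: "x \<in> carrier H \<Longrightarrow> - x \<in> carrier H"
  using subspace_carrier
  by (simp_all add: complex_vector.subspace_0 complex_vector.subspace_add
      complex_vector.subspace_diff complex_vector.subspace_scale complex_vector.subspace_neg)

lemma ip_cnj: "x \<in> carrier H \<Longrightarrow> y \<in> carrier H \<Longrightarrow> ip H y x = cnj (ip H x y)"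
  by (rule ips[unfolded inner_product_space_def, THEN conjunct2, THEN conjunct1, rule_format])

lemma ip_add_right: "x \<in> carrier H \<Longrightarrow> y \<in> carrier H \<Longrightarrow> z \<in> carrier H \<Longrightarrow>
    ip H x (y + z) = ip H x y + ip H x z"
  by (rule ips[unfolded inner_product_space_def, THEN conjunct2, THEN conjunct2, THEN conjunct1, rule_format])

lemma ip_scale_right: "x \<in> carrier H \<Longrightarrow> y \<in> carrier H \<Longrightarrow> ip H x (c *\<^sub>C y) = c * ip H x y"
  by (rule ips[unfolded inner_product_space_def, THEN conjunct2, THEN conjunct2, THEN conjunct2, THEN conjunct1, rule_format])

lemma ip_pos: "x \<in> carrier H \<Longrightarrow> x \<noteq> 0 \<Longrightarrow> 0 < Re (ip H x x)"
  by (rule ips[unfolded inner_product_space_def, THEN conjunct2, THEN conjunct2, THEN conjunct2, THEN conjunct2, rule_format])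

lemma ip_add_left: "x \<in> carrier H \<Longrightarrow> y \<in> carrier H \<Longrightarrow> z \<in> carrier H \<Longrightarrow>
    ip H (x + y) z = ip H x z + ip H y z"
  by (metis carrier_add complex_cnj_add ip_add_right ip_cnj)

lemma ip_scale_left: "x \<in> carrier H \<Longrightarrow> y \<in> carrier H \<Longrightarrow> ip H (c *\<^sub>C x) y = cnj c * ip H x y"
  by (metis carrier_scale complex_cnj_mult ip_scale_right ip_cnj)

lemma ip_minus_right: "x \<in> carrier H \<Longrightarrow> y \<in> carrier H \<Longrightarrow> ip H x (- y) = - ip H x y"
  using ip_scale_right[of x y "-1"] by simp

lemma ip_minus_left: "x \<in> carrier H \<Longrightarrow> y \<in> carrier H \<Longrightarrow> ip H (- x) y = - ip H x y"
  using ip_scale_left[of x y "-1"] by simp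

lemma ip_diff_right: "x \<in> carrier H \<Longrightarrow> y \<in> carrier H \<Longrightarrow> z \<in> carrier H \<Longrightarrow>
    ip H x (y - z) = ip H x y - ip H x z"
  using ip_add_right[of x y "-z"] by (simp add: ip_minus_right)

lemma ip_diff_left: "x \<in> carrier H \<Longrightarrow> y \<in> carrier H \<Longrightarrow> z \<in> carrier H \<Longrightarrow>
    ip H (x - y) z = ip H x z - ip H y z"
  using ip_add_left[of x "-y" z] by (simp add: ip_minus_left)

lemma ip_zero_right [simp]: "x \<in> carrier H \<Longrightarrow> ip H x 0 = 0"
  using ip_scale_right[of x 0 0] by simp

lemma ip_zero_left [simp]: "x \<in> carrier H \<Longrightarrow> ip H 0 x = 0"
  using ip_scale_left[of 0 x 0] by simp

lemmas ip_simps = ip_add_left ip_add_right ip_diff_left ip_diff_right ip_minus_left ip_minus_right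
  ip_scale_left ip_scale_right

lemma Im_ip_self: "x \<in> carrier H \<Longrightarrow> Im (ip H x x) = 0"
  using ip_cnj[of x x] by (simp add: complex_eq_iff)

lemma Re_ip_self_nonneg: "x \<in> carrier H \<Longrightarrow> 0 \<le> Re (ip H x x)"
  by (cases "x = 0") (auto dest: ip_pos)

lemma hnorm_power2: "x \<in> carrier H \<Longrightarrow> (hnorm H x)\<^sup>2 = Re (ip H x x)"
  by (simp add: hnorm_def Re_ip_self_nonneg)

lemma ip_self: "x \<in> carrier H \<Longrightarrow> ip H x x = complex_of_real ((hnorm H x)\<^sup>2)"
  by (simp add: complex_eq_iff hnorm_power2 Im_ip_self)

lemma hnorm_nonneg: "x \<in> carrier H \<Longrightarrow> 0 \<le> hnorm H x"
  by (simp add: hnorm_def Re_ip_self_nonneg)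

lemma hnorm_eq_0: "x \<in> carrier H \<Longrightarrow> hnorm H x = 0 \<longleftrightarrow> x = 0"
  using ip_pos[of x] by (cases "x = 0") (auto simp: hnorm_def)

lemma hnorm_zero [simp]: "hnorm H 0 = 0"
  by (simp add: hnorm_def)

lemma hnorm_scale: "x \<in> carrier H \<Longrightarrow> hnorm H (c *\<^sub>C x) = cmod c * hnorm H x"
proof -
  assume x: "x \<in> carrier H"
  have "ip H (c *\<^sub>C x) (c *\<^sub>C x) = (c * cnj c) * ip H x x"
    using x by (simp add: ip_simps)
  also have "\<dots> = complex_of_real ((cmod c)\<^sup>2 * (hnorm H x)\<^sup>2)"
    using x by (simp add: ip_self flip: complex_norm_square)
  finally have "(hnorm H (c *\<^sub>C x))\<^sup>2 = (cmod c * hnorm H x)\<^sup>2"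
    using x by (simp add: hnorm_power2 power_mult_distrib del: of_real_mult)
  then show ?thesis
    using x by (simp add: power2_eq_iff_nonneg hnorm_nonneg)
qed

lemma hnorm_minus: "x \<in> carrier H \<Longrightarrow> hnorm H (- x) = hnorm H x"
  using hnorm_scale[of x "-1"] by simp

lemma hnorm_minus_commute: "x \<in> carrier H \<Longrightarrow> y \<in> carrier H \<Longrightarrow> hnorm H (x - y) = hnorm H (y - x)"
  using hnorm_minus[of "x - y"] by simp

lemma hnorm_add_power2: "x \<in> carrier H \<Longrightarrow> y \<in> carrier H \<Longrightarrow>
    (hnorm H (x + y))\<^sup>2 = (hnorm H x)\<^sup>2 + (hnorm H y)\<^sup>2 + 2 * Re (ip H x y)"
  using ip_cnj[of x y] by (simp add: hnorm_power2 ip_simps)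

lemma hnorm_diff_power2: "x \<in> carrier H \<Longrightarrow> y \<in> carrier H \<Longrightarrow>
    (hnorm H (x - y))\<^sup>2 = (hnorm H x)\<^sup>2 + (hnorm H y)\<^sup>2 - 2 * Re (ip H x y)"
  using ip_cnj[of x y] by (simp add: hnorm_power2 ip_simps)

lemma parallelogram: "x \<in> carrier H \<Longrightarrow> y \<in> carrier H \<Longrightarrow>
    (hnorm H (x + y))\<^sup>2 + (hnorm H (x - y))\<^sup>2 = 2 * (hnorm H x)\<^sup>2 + 2 * (hnorm H y)\<^sup>2"
  by (simp add: hnorm_add_power2 hnorm_diff_power2)

lemma Cauchy_Schwarz:
  assumes x: "x \<in> carrier H" and y: "y \<in> carrier H"
  shows "cmod (ip H x y) \<le> hnorm H x * hnorm H y"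
proof (cases "y = 0")
  case False
  define n where "n = (hnorm H y)\<^sup>2"
  have n: "0 < n" using ip_pos[OF y False] by (simp add: n_def hnorm_power2 y)
  \<comment> \<open>\<open>c *\<^sub>C y\<close> is the orthogonal projection of \<open>x\<close>
    onto the line through \<open>y\<close>; the claim is that the squared norm of the remainder is
    nonnegative.\<close>
  define c where "c = ip H y x / complex_of_real n"
  have eq: "Re (ip H x (c *\<^sub>C y)) = (cmod (ip H x y))\<^sup>2 / n"
    using x y ip_cnj[of x y]
    by (simp add: ip_simps c_def cmod_power2) (simp add: power2_eq_square add_divide_distrib)
  have "cmod c = cmod (ip H x y) / n"
    using n ip_cnj[OF x y] by (simp add: c_def norm_divide)
  then have "(hnorm H (c *\<^sub>C y))\<^sup>2 = (cmod (ip H x y))\<^sup>2 / n"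
    using n y by (simp add: hnorm_scale power_mult_distrib power_divide flip: n_def)
      (simp add: power2_eq_square)
  then have "0 \<le> (hnorm H x)\<^sup>2 - (cmod (ip H x y))\<^sup>2 / n"
    using hnorm_diff_power2[of x "c *\<^sub>C y"] eq x y
      zero_le_power2[of "hnorm H (x - c *\<^sub>C y)"] by simp
  then have "(cmod (ip H x y))\<^sup>2 \<le> (hnorm H x * hnorm H y)\<^sup>2"
    using n by (simp add: field_simps power_mult_distrib flip: n_def)
  then show ?thesis
    by (rule power2_le_imp_le) (simp add: x y hnorm_nonneg)
qed (use x in simp)

lemma hnorm_triangle:
  assumes x: "x \<in> carrier H" and y: "y \<in> carrier H"
  shows "hnorm H (x + y) \<le> hnorm H x + hnorm H y"
proof -
  have "Re (ip H x y) \<le> hnorm H x * hnorm H y"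
    using Cauchy_Schwarz[OF x y] complex_Re_le_cmod order_trans by blast
  then have "(hnorm H (x + y))\<^sup>2 \<le> (hnorm H x + hnorm H y)\<^sup>2"
    by (simp add: hnorm_add_power2 x y power2_sum)
  then show ?thesis
    by (rule power2_le_imp_le) (simp add: x y hnorm_nonneg)
qed

lemma hnorm_triangle_diff: "x \<in> carrier H \<Longrightarrow> y \<in> carrier H \<Longrightarrow> hnorm H (x - y) \<le> hnorm H x + hnorm H y"
  using hnorm_triangle[of x "-y"] by (simp add: hnorm_minus)

lemma hnorm_dist_triangle: "x \<in> carrier H \<Longrightarrow> y \<in> carrier H \<Longrightarrow> z \<in> carrier H \<Longrightarrow>
    hnorm H (x - z) \<le> hnorm H (x - y) + hnorm H (y - z)"
  using hnorm_triangle[of "x - y" "y - z"] by simp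

lemma hnorm_reverse_triangle: "x \<in> carrier H \<Longrightarrow> y \<in> carrier H \<Longrightarrow>
    \<bar>hnorm H x - hnorm H y\<bar> \<le> hnorm H (x - y)"
  using hnorm_triangle[of "x - y" y] hnorm_triangle[of "y - x" x] hnorm_minus_commute[of x y] by simp

lemma hconverges_hnorm:
  assumes "range s \<subseteq> carrier H" "x \<in> carrier H" "hconverges H s x"
  shows "(\<lambda>n. hnorm H (s n)) \<longlonglongrightarrow> hnorm H x"
  by (rule LIM_zero_cancel, rule Lim_null_comparison[where g="\<lambda>n. hnorm H (s n - x)"])
    (use assms hnorm_reverse_triangle in \<open>auto simp: hconverges_def image_subset_iff\<close>)

lemma hconverges_ip_right:
  assumes "range s \<subseteq> carrier H" "x \<in> carrier H" "hconverges H s x" "y \<in> carrier H"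
  shows "(\<lambda>n. ip H y (s n)) \<longlonglongrightarrow> ip H y x"
proof (rule LIM_zero_cancel, rule Lim_null_comparison)
  show "\<forall>\<^sub>F n in sequentially. cmod (ip H y (s n) - ip H y x) \<le> hnorm H y * hnorm H (s n - x)"
    using assms Cauchy_Schwarz[OF assms(4)]
    by (auto simp: image_subset_iff simp flip: ip_diff_right)
  show "(\<lambda>n. hnorm H y * hnorm H (s n - x)) \<longlonglongrightarrow> 0"
    using assms(3) by (auto simp: hconverges_def intro: tendsto_mult_right_zero)
qed

lemma hconverges_ip_left:
  assumes "range s \<subseteq> carrier H" "x \<in> carrier H" "hconverges H s x" "y \<in> carrier H"
  shows "(\<lambda>n. ip H (s n) y) \<longlonglongrightarrow> ip H x y"
proof -
  have "(\<lambda>n. cnj (ip H y (s n))) \<longlonglongrightarrow> cnj (ip H y x)"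
    using hconverges_ip_right[OF assms] by (rule tendsto_cnj)
  moreover have "cnj (ip H y (s n)) = ip H (s n) y" for n
    using assms by (intro ip_cnj[symmetric]) (auto simp: image_subset_iff)
  ultimately show ?thesis
    using ip_cnj[OF assms(4) assms(2)] by simp
qed

lemma hconverges_diff:
  assumes "range s \<subseteq> carrier H" "range t \<subseteq> carrier H" "x \<in> carrier H" "y \<in> carrier H"
    and "hconverges H s x" "hconverges H t y"
  shows "hconverges H (\<lambda>n. s n - t n) (x - y)"
  unfolding hconverges_def
proof (rule Lim_null_comparison)
  have "hnorm H (s n - t n - (x - y)) \<le> hnorm H (s n - x) + hnorm H (t n - y)" for n
    using assms hnorm_triangle_diff[of "s n - x" "t n - y"]
    by (simp add: image_subset_iff algebra_simps)
  then show "\<forall>\<^sub>F n in sequentially. norm (hnorm H (s n - t n - (x - y))) \<le>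
      hnorm H (s n - x) + hnorm H (t n - y)"
    using assms by (simp add: hnorm_nonneg image_subset_iff)
  show "(\<lambda>n. hnorm H (s n - x) + hnorm H (t n - y)) \<longlonglongrightarrow> 0"
    using tendsto_add[OF assms(5,6)[unfolded hconverges_def]] by simp
qed

lemma hconverges_scale:
  assumes "range s \<subseteq> carrier H" "x \<in> carrier H" "hconverges H s x"
  shows "hconverges H (\<lambda>n. c *\<^sub>C s n) (c *\<^sub>C x)"
proof -
  have "hnorm H (c *\<^sub>C s n - c *\<^sub>C x) = cmod c * hnorm H (s n - x)" for n
    using assms by (simp add: image_subset_iff hnorm_scale flip: complex_vector.scale_right_diff_distrib)
  then show ?thesis
    using assms(3) by (auto simp: hconverges_def intro: tendsto_mult_right_zero)
qed

lemma hconverges_unique: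
  assumes "range s \<subseteq> carrier H" "x \<in> carrier H" "y \<in> carrier H"
    and "hconverges H s x" "hconverges H s y"
  shows "x = y"
proof -
  \<comment> \<open>The zero sequence, seen as a difference of \<open>s\<close> with itself,
    converges to \<open>x - y\<close>.\<close>
  have "hconverges H (\<lambda>n. s n - s n) (x - y)"
    using assms by (intro hconverges_diff)
  then have "(\<lambda>n::nat. hnorm H (y - x)) \<longlonglongrightarrow> 0"
    by (simp add: hconverges_def)
  then show ?thesis
    using assms hnorm_eq_0[of "y - x"] by (simp add: LIMSEQ_const_iff)
qed

lemma hconverges_imp_hCauchy:
  assumes "range s \<subseteq> carrier H" "x \<in> carrier H" "hconverges H s x"
  shows "hCauchy H s"
  unfolding hCauchy_def
proof (intro allI impI)
  fix e :: real assume "e > 0"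
  then have "e / 2 > 0" by simp
  then obtain N where N: "\<And>n. n \<ge> N \<Longrightarrow> norm (hnorm H (s n - x) - 0) < e / 2"
    using assms(3) unfolding hconverges_def by (metis LIMSEQ_D)
  have "hnorm H (s m - s n) < e" if "m \<ge> N" "n \<ge> N" for m n
    using hnorm_dist_triangle[of "s m" x "s n"] N[OF that(1)] N[OF that(2)] assms
      hnorm_minus_commute[of x "s n"] by (auto simp: image_subset_iff)
  then show "\<exists>N. \<forall>m\<ge>N. \<forall>n\<ge>N. hnorm H (s m - s n) < e" by blast
qed

text \<open>By Pythagoras a vector orthogonal to \<open>x\<close> is at distance at least
  \<open>\<parallel>x\<parallel>\<close> from it, so a set of such vectors cannot approximate a
  nonzero \<open>x\<close>.\<close>

lemma eq_zero_if_orth_dense: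
  assumes "dense_in H S" "x \<in> carrier H" and orth: "\<And>y. y \<in> S \<Longrightarrow> ip H y x = 0"
  shows "x = 0"
proof (rule ccontr)
  assume "x \<noteq> 0"
  then have "hnorm H x > 0"
    using assms(2) hnorm_eq_0[of x] hnorm_nonneg[of x] by simp
  then obtain y where y: "y \<in> S" "hnorm H (x - y) < hnorm H x"
    using assms(1,2) unfolding dense_in_def by blast
  then have yc: "y \<in> carrier H" using assms(1) by (auto simp: dense_in_def)
  have "(hnorm H (x - y))\<^sup>2 = (hnorm H x)\<^sup>2 + (hnorm H y)\<^sup>2"
    using assms(2) yc orth[OF y(1)] ip_cnj[of y x] by (simp add: hnorm_diff_power2)
  moreover have "(hnorm H (x - y))\<^sup>2 < (hnorm H x)\<^sup>2"
    using y(2) assms(2) yc by (simp add: hnorm_nonneg power_strict_mono)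
  ultimately show False
    using zero_le_power2[of "hnorm H y"] by linarith
qed

end

section \<open>Orthogonal projection and density in complete spaces\<close>

locale hilbert = ips +
  assumes complete: "range s \<subseteq> carrier H \<Longrightarrow> hCauchy H s \<Longrightarrow> \<exists>x\<in>carrier H. hconverges H s x"
begin

text \<open>No closedness of the subspace is assumed; the projection lies in its closure.\<close>

lemma projection:
  assumes M: "complex_vector.subspace M" "M \<subseteq> carrier H" and x: "x \<in> carrier H"
  obtains s y where "range s \<subseteq> M" "y \<in> carrier H" "hconverges H s y" "\<And>z. z \<in> M \<Longrightarrow> ip H z (x - y) = 0"
proof -
  \<comment> \<open>Squared distances are minimised because the parallelogram law, which makes
    minimising sequences Cauchy, is about squares.\<close>
  define d where "d = (INF z\<in>M. (hnorm H (x - z))\<^sup>2)"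
  have ne: "M \<noteq> {}" using complex_vector.subspace_0[OF M(1)] by blast
  have bdd: "bdd_below ((\<lambda>z. (hnorm H (x - z))\<^sup>2) ` M)"
    by (rule bdd_belowI[of _ 0]) auto
  have d_le: "d \<le> (hnorm H (x - z))\<^sup>2" if "z \<in> M" for z
    unfolding d_def using bdd that by (rule cINF_lower)
  have ex: "\<exists>z\<in>M. (hnorm H (x - z))\<^sup>2 < d + e" if "e > 0" for e
    using cINF_less_iff[OF ne bdd, of "d + e"] that unfolding d_def by auto
  have "\<forall>n. \<exists>z\<in>M. (hnorm H (x - z))\<^sup>2 < d + 1 / real (Suc n)"
    using ex by simp
  then obtain s where s: "\<And>n. s n \<in> M" "\<And>n. (hnorm H (x - s n))\<^sup>2 < d + 1 / real (Suc n)"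
    by metis
  have sc: "s n \<in> carrier H" for n using s(1) M(2) by blast
  have close: "(hnorm H (s m - s n))\<^sup>2 \<le> 2 / real (Suc m) + 2 / real (Suc n)" for m n
  proof -
    \<comment> \<open>The midpoint stays in \<open>M\<close>, so its squared distance to
      \<open>x\<close> is at least \<open>d\<close>; the parallelogram law then leaves little room
      for \<open>s m - s n\<close>.\<close>
    define a where "a = (1/2) *\<^sub>C (s m + s n)"
    have a: "a \<in> M" unfolding a_def
      using s(1) M(1) by (intro complex_vector.subspace_scale complex_vector.subspace_add) auto
    then have ac: "a \<in> carrier H" using M(2) by blast
    have two: "2 *\<^sub>C v = v + v" for v :: 'a
      using scaleC_add_left[of 1 1 v] by (simp add: scaleC_one)
    have "x - s n + (x - s m) = 2 *\<^sub>C (x - a)"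
      by (simp add: a_def complex_vector.scale_right_diff_distrib) (simp add: two algebra_simps)
    then have "(hnorm H (x - s n + (x - s m)))\<^sup>2 = 4 * (hnorm H (x - a))\<^sup>2"
      using x ac by (simp add: hnorm_scale power_mult_distrib)
    moreover have "x - s n - (x - s m) = s m - s n" by simp
    ultimately have "4 * (hnorm H (x - a))\<^sup>2 + (hnorm H (s m - s n))\<^sup>2
        = 2 * (hnorm H (x - s n))\<^sup>2 + 2 * (hnorm H (x - s m))\<^sup>2"
      using parallelogram[of "x - s n" "x - s m"] x sc by simp
    then show ?thesis
      using d_le[OF a] s(2)[of m] s(2)[of n] by (simp del: of_nat_Suc)
  qed
  have "hCauchy H s" unfolding hCauchy_def
  proof (intro allI impI)
    fix e :: real assume e: "e > 0"
    obtain N where N: "1 / real (Suc N) < e\<^sup>2 / 4"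
      using nat_approx_posE[of "e\<^sup>2 / 4"] e by auto
    have "hnorm H (s m - s n) < e" if "m \<ge> N" "n \<ge> N" for m n
    proof (rule power2_less_imp_less)
      have "1 / real (Suc m) \<le> 1 / real (Suc N)" "1 / real (Suc n) \<le> 1 / real (Suc N)"
        using that by (simp_all add: frac_le)
      then show "(hnorm H (s m - s n))\<^sup>2 < e\<^sup>2"
        using close[of m n] N by simp
    qed (use e in simp)
    then show "\<exists>N. \<forall>m\<ge>N. \<forall>n\<ge>N. hnorm H (s m - s n) < e" by blast
  qed
  then obtain y where y: "y \<in> carrier H" "hconverges H s y"
    using complete[of s] sc by blast
  have rs: "range (\<lambda>n. x - s n) \<subseteq> carrier H" using sc x by auto
  have "hconverges H (\<lambda>n. x - s n) (x - y)"
    using sc x y by (intro hconverges_diff) (auto simp: hconverges_def)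
  then have lim: "(\<lambda>n. (hnorm H (x - s n))\<^sup>2) \<longlonglongrightarrow> (hnorm H (x - y))\<^sup>2"
    using hconverges_hnorm[OF rs] x y by (intro tendsto_power) simp
  have lim2: "(\<lambda>n. d + 1 / real (Suc n)) \<longlonglongrightarrow> d"
    using tendsto_add[OF tendsto_const[of d] LIMSEQ_Suc[OF lim_1_over_n]] by simp
  have yd: "(hnorm H (x - y))\<^sup>2 \<le> d"
    using lim lim2 by (rule LIMSEQ_le) (use s(2) less_imp_le in blast)
  \<comment> \<open>\<open>y\<close> need not lie in \<open>M\<close>, so minimality at
    \<open>y + z\<close> is obtained as a limit of minimality at \<open>s n + z\<close>.\<close>
  have key: "d \<le> (hnorm H (x - y - z))\<^sup>2" if "z \<in> M" for z
  proof -
    have zc: "z \<in> carrier H" using that M(2) by blast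
    have "hconverges H (\<lambda>n. x - s n - z) (x - y - z)"
      using \<open>hconverges H (\<lambda>n. x - s n) (x - y)\<close> by (simp add: hconverges_def)
    then have "(\<lambda>n. (hnorm H (x - s n - z))\<^sup>2) \<longlonglongrightarrow> (hnorm H (x - y - z))\<^sup>2"
      using sc x y zc by (intro tendsto_power hconverges_hnorm) auto
    moreover have "d \<le> (hnorm H (x - s n - z))\<^sup>2" for n
      using d_le[of "s n + z"] complex_vector.subspace_add[OF M(1) s(1) that]
      by (simp add: diff_diff_add)
    ultimately show ?thesis by (intro LIMSEQ_le_const) auto
  qed
  have "ip H z (x - y) = 0" if z: "z \<in> M" for z
  proof (rule ccontr)
    assume nz: "ip H z (x - y) \<noteq> 0"
    define p where "p = ip H z (x - y)"
    have zc: "z \<in> carrier H" using z M(2) by blast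
    have xy: "x - y \<in> carrier H" using x y by simp
    have "z \<noteq> 0" using nz xy by auto
    then have n: "0 < (hnorm H z)\<^sup>2" using ip_pos[OF zc] by (simp add: hnorm_power2 zc)
    \<comment> \<open>\<open>c *\<^sub>C z\<close> is the projection of \<open>x - y\<close> onto
      \<open>z\<close>; subtracting it would lower the squared distance by
      \<open>(cmod p)\<^sup>2 / (hnorm H z)\<^sup>2\<close>, below the infimum.\<close>
    define c where "c = p / complex_of_real ((hnorm H z)\<^sup>2)"
    have "c *\<^sub>C z \<in> M" using M(1) z by (rule complex_vector.subspace_scale)
    from key[OF this] have "d \<le> (hnorm H (x - y - c *\<^sub>C z))\<^sup>2" .
    also have "\<dots> = (hnorm H (x - y))\<^sup>2 + (hnorm H (c *\<^sub>C z))\<^sup>2 - 2 * Re (ip H (x - y) (c *\<^sub>C z))"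
      by (rule hnorm_diff_power2) (use xy zc in auto)
    also have "ip H (x - y) (c *\<^sub>C z) = c * cnj p"
      using xy zc ip_cnj[OF zc xy] by (simp add: ip_scale_right p_def)
    also have "c * cnj p = complex_of_real ((cmod p)\<^sup>2 / (hnorm H z)\<^sup>2)"
      by (simp add: c_def flip: complex_norm_square)
    also have "(hnorm H (c *\<^sub>C z))\<^sup>2 = (cmod p)\<^sup>2 / (hnorm H z)\<^sup>2"
    proof -
      have "cmod c = cmod p / (hnorm H z)\<^sup>2" by (simp add: c_def norm_divide norm_power)
      then have "(hnorm H (c *\<^sub>C z))\<^sup>2 = (cmod p)\<^sup>2 / ((hnorm H z)\<^sup>2 * (hnorm H z)\<^sup>2) * (hnorm H z)\<^sup>2"
        using zc by (simp add: hnorm_scale power_mult_distrib power_divide power2_eq_square)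
      then show ?thesis using n by (simp add: power2_eq_square)
    qed
    finally have "(cmod p)\<^sup>2 / (hnorm H z)\<^sup>2 \<le> 0" using yd by simp
    then show False using n nz by (simp add: p_def divide_le_0_iff)
  qed
  then show thesis using that[of s y] s(1) y by blast
qed

text \<open>The residual of the projection is orthogonal to \<open>M\<close>, hence zero, so every
  vector is itself the limit of a sequence in \<open>M\<close>.\<close>

lemma dense_if_orth_trivial:
  assumes M: "complex_vector.subspace M" "M \<subseteq> carrier H"
    and triv: "\<And>w. w \<in> carrier H \<Longrightarrow> (\<And>z. z \<in> M \<Longrightarrow> ip H z w = 0) \<Longrightarrow> w = 0"
  shows "dense_in H M"
  unfolding dense_in_def
proof (intro conjI ballI allI impI)
  show "M \<subseteq> carrier H" by fact
  fix x and e :: real assume x: "x \<in> carrier H" and e: "e > 0"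
  obtain s y where s: "range s \<subseteq> M" "y \<in> carrier H" "hconverges H s y"
      "\<And>z. z \<in> M \<Longrightarrow> ip H z (x - y) = 0"
    using projection[OF M x] by metis
  have "x - y = 0" by (rule triv) (use x s in auto)
  then have "x = y" by simp
  obtain n where "norm (hnorm H (s n - y) - 0) < e"
    using s(3) e unfolding hconverges_def by (meson LIMSEQ_D order_refl)
  then have "hnorm H (x - s n) < e"
    using hnorm_minus_commute[of "s n" y] s(1,2) M(2) \<open>x = y\<close> by (auto simp: image_subset_iff subset_iff)
  then show "\<exists>y\<in>M. hnorm H (x - y) < e" using s(1) by auto
qed

end

lemma hilbert_iff: "hilbert_space H \<longleftrightarrow> hilbert H"
  by (auto simp: hilbert_space_def hilbert_def ips_def hilbert_axioms_def)

lemma linear_opD: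
  assumes "linear_op H K T"
  shows "hilbert_space H" "hilbert_space K" "complex_vector.subspace (dom T)" "dom T \<subseteq> carrier H"
    "ran T \<subseteq> carrier K"
    "f \<in> dom T \<Longrightarrow> g \<in> dom T \<Longrightarrow> the (T (f + g)) = the (T f) + the (T g)"
    "f \<in> dom T \<Longrightarrow> the (T (c *\<^sub>C f)) = c *\<^sub>C the (T f)"
    "f \<in> dom T \<Longrightarrow> the (T f) \<in> carrier K"
  using assms unfolding linear_op_def by (auto simp: ran_def)

subsection \<open>Skew-adjoint operators and their resolvents\<close>

context ips
begin

lemma eq_if_ip_eq:
  assumes "x \<in> carrier H" "y \<in> carrier H" "\<And>z. z \<in> carrier H \<Longrightarrow> ip H x z = ip H y z"
  shows "x = y"
  using assms ip_pos[of "x - y"] by (force simp: ip_diff_left)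

text \<open>\<open>ip H (F x) z\<close> equals \<open>ip H x (F' z)\<close>, which depends linearly
  on \<open>x\<close> up to conjugation of scalars, and these products determine \<open>F x\<close>.
  This yields linearity of maps specified by a choice operator, such as \<open>E\<close> and
  \<open>W\<close>, without examining the choice.\<close>

lemma linear_if_adjoint:
  assumes F: "\<And>x. x \<in> carrier H \<Longrightarrow> F x \<in> carrier H"
    and F': "\<And>x. x \<in> carrier H \<Longrightarrow> F' x \<in> carrier H"
    and adj: "\<And>x y. x \<in> carrier H \<Longrightarrow> y \<in> carrier H \<Longrightarrow> ip H (F x) y = ip H x (F' y)"
    and x: "x \<in> carrier H" and y: "y \<in> carrier H"
  shows "F (x + y) = F x + F y" "F (x - y) = F x - F y" "F (c *\<^sub>C x) = c *\<^sub>C F x"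
  by (rule eq_if_ip_eq; simp add: assms ip_simps)+

text \<open>Compatibility with differences is included so that the bound on norms becomes a bound on
  distances.\<close>

definition contraction :: "('a \<Rightarrow> 'a) \<Rightarrow> bool"
  where "contraction F \<longleftrightarrow> (\<forall>x\<in>carrier H. F x \<in> carrier H \<and> hnorm H (F x) \<le> hnorm H x) \<and>
    (\<forall>x\<in>carrier H. \<forall>y\<in>carrier H. F (x - y) = F x - F y)"

lemma contractionD:
  assumes "contraction F" "x \<in> carrier H"
  shows "F x \<in> carrier H" "hnorm H (F x) \<le> hnorm H x"
    "y \<in> carrier H \<Longrightarrow> F (x - y) = F x - F y"
    "y \<in> carrier H \<Longrightarrow> hnorm H (F x - F y) \<le> hnorm H (x - y)"
  using assms unfolding contraction_def by (auto, metis carrier_diff)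

lemma contraction_id: "contraction (\<lambda>x. x)"
  by (simp add: contraction_def)

lemma contraction_comp: "contraction F \<Longrightarrow> contraction G \<Longrightarrow> contraction (\<lambda>x. F (G x))"
  unfolding contraction_def by (metis order_trans)

lemma contraction_funpow: "contraction F \<Longrightarrow> contraction (F ^^ n)"
proof (induction n)
  case 0
  then show ?case by (simp add: contraction_def)
next
  case (Suc n)
  from contraction_comp[OF Suc.prems Suc.IH[OF Suc.prems]] show ?case by (simp add: comp_def)
qed

lemma funpow_commute:
  assumes "contraction Q" "\<And>x. x \<in> carrier H \<Longrightarrow> P (Q x) = Q (P x)" "x \<in> carrier H"
  shows "P ((Q ^^ n) x) = (Q ^^ n) (P x)"
  using assms by (induction n) (auto simp: contractionD(1)[OF contraction_funpow])

lemma funpow_comp_commute: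
  assumes "contraction P" "contraction Q" "\<And>x. x \<in> carrier H \<Longrightarrow> P (Q x) = Q (P x)" "x \<in> carrier H"
  shows "((\<lambda>x. P (Q x)) ^^ n) x = (P ^^ n) ((Q ^^ n) x)"
proof (induction n)
  case (Suc n)
  have c: "(Q ^^ n) x \<in> carrier H"
    using assms by (simp add: contractionD(1)[OF contraction_funpow])
  have "((\<lambda>x. P (Q x)) ^^ Suc n) x = P (Q ((P ^^ n) ((Q ^^ n) x)))"
    using Suc by simp
  also have "Q ((P ^^ n) ((Q ^^ n) x)) = (P ^^ n) (Q ((Q ^^ n) x))"
    by (rule funpow_commute) (use assms c in auto)
  finally show ?case by simp
qed simp

text \<open>Telescoping: \<open>P\<^sup>n - Q\<^sup>n\<close> is a sum of \<open>n\<close> terms,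
  each a product of powers of \<open>P\<close> and \<open>Q\<close> with one factor
  \<open>P - Q\<close>. Commutation moves that factor onto \<open>x\<close> and contractivity
  discards the rest, so a one-step error at the single vector \<open>x\<close> controls all
  \<open>n\<close> steps.\<close>

lemma funpow_diff_le:
  assumes P: "contraction P" and Q: "contraction Q"
    and PQ: "\<And>x. x \<in> carrier H \<Longrightarrow> P (Q x) = Q (P x)" and x: "x \<in> carrier H"
  shows "hnorm H ((P ^^ n) x - (Q ^^ n) x) \<le> real n * hnorm H (P x - Q x)"
proof (induction n)
  case (Suc n)
  note cP = contractionD[OF contraction_funpow[OF P]]
  note cQ = contractionD[OF contraction_funpow[OF Q]]
  have c: "(P ^^ n) x \<in> carrier H" "(Q ^^ n) x \<in> carrier H" "P x \<in> carrier H" "Q x \<in> carrier H"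
    using P Q x by (simp_all add: cP cQ contractionD)
  have "hnorm H ((P ^^ Suc n) x - (Q ^^ Suc n) x) \<le>
      hnorm H (P ((P ^^ n) x) - P ((Q ^^ n) x)) + hnorm H (P ((Q ^^ n) x) - Q ((Q ^^ n) x))"
    using hnorm_dist_triangle[of "P ((P ^^ n) x)" "P ((Q ^^ n) x)" "Q ((Q ^^ n) x)"] c P Q
    by (simp add: contractionD)
  also have "hnorm H (P ((P ^^ n) x) - P ((Q ^^ n) x)) \<le> real n * hnorm H (P x - Q x)"
    using contractionD(4)[OF P c(1,2)] Suc by simp
  also have "P ((Q ^^ n) x) - Q ((Q ^^ n) x) = (Q ^^ n) (P x) - (Q ^^ n) (Q x)"
    using funpow_commute[of Q P x n] Q PQ x by (simp add: funpow_swap1)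
  also have "hnorm H \<dots> \<le> hnorm H (P x - Q x)"
    using cQ(4)[OF c(3,4)] .
  finally show ?case by (simp add: algebra_simps)
qed simp

lemma contraction_eq_dense:
  assumes F: "contraction F" and G: "contraction G" and S: "dense_in H S"
    and eq: "\<And>x. x \<in> S \<Longrightarrow> F x = G x" and x: "x \<in> carrier H"
  shows "F x = G x"
proof (rule ccontr)
  assume ne: "F x \<noteq> G x"
  have c: "F x \<in> carrier H" "G x \<in> carrier H" using F G x by (auto simp: contractionD)
  define e where "e = hnorm H (F x - G x)"
  have "e > 0" unfolding e_def
    using ne c hnorm_eq_0[of "F x - G x"] hnorm_nonneg[of "F x - G x"] by simp
  then have "e / 2 > 0" by simp
  then obtain y where y: "y \<in> S" "hnorm H (x - y) < e / 2"
    using S x unfolding dense_in_def by blast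
  have yc: "y \<in> carrier H" using y(1) S by (auto simp: dense_in_def)
  have "e \<le> hnorm H (F x - F y) + hnorm H (G y - G x)"
    using hnorm_dist_triangle[of "F x" "F y" "G x"] eq[OF y(1)] c F G yc
    by (simp add: e_def contractionD)
  then show False
    using contractionD(4)[OF F x yc] contractionD(4)[OF G yc x] y(2) hnorm_minus_commute[OF x yc]
    by simp
qed

end

text \<open>\<open>maximal\<close> says that the adjoint of \<open>g\<close> is contained in \<open>- g\<close>.\<close>

locale skew_adjoint = hilbert H for H :: "'a::complex_vector hspace" +
  fixes D :: "'a set" and g :: "'a \<Rightarrow> 'a"
  assumes subspace_D: "complex_vector.subspace D"
    and dense_D: "dense_in H D"
    and g_carrier: "x \<in> D \<Longrightarrow> g x \<in> carrier H"
    and g_add: "x \<in> D \<Longrightarrow> y \<in> D \<Longrightarrow> g (x + y) = g x + g y"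
    and g_scale: "x \<in> D \<Longrightarrow> g (c *\<^sub>C x) = c *\<^sub>C g x"
    and skew: "x \<in> D \<Longrightarrow> y \<in> D \<Longrightarrow> ip H (g x) y = - ip H x (g y)"
    and maximal: "y \<in> carrier H \<Longrightarrow> z \<in> carrier H \<Longrightarrow>
      (\<And>x. x \<in> D \<Longrightarrow> ip H (g x) y = - ip H x z) \<Longrightarrow> y \<in> D \<and> g y = z"
begin

lemma D_carrier: "x \<in> D \<Longrightarrow> x \<in> carrier H"
  using dense_D by (auto simp: dense_in_def)

lemma D_add: "x \<in> D \<Longrightarrow> y \<in> D \<Longrightarrow> x + y \<in> D"
  and D_diff: "x \<in> D \<Longrightarrow> y \<in> D \<Longrightarrow> x - y \<in> D"
  and D_scale: "x \<in> D \<Longrightarrow> c *\<^sub>C x \<in> D"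
  and D_zero: "0 \<in> D"
  using subspace_D
  by (simp_all add: complex_vector.subspace_add complex_vector.subspace_diff
      complex_vector.subspace_scale complex_vector.subspace_0)

lemma g_diff: "x \<in> D \<Longrightarrow> y \<in> D \<Longrightarrow> g (x - y) = g x - g y"
  using g_add[of x "(-1) *\<^sub>C y"] g_scale[of y "-1"] D_scale[of y "-1"] by simp

lemma Re_ip_g: "x \<in> D \<Longrightarrow> Re (ip H x (g x)) = 0"
  using skew[of x x] ip_cnj[of x "g x"] by (simp add: D_carrier g_carrier complex_eq_iff)

text \<open>The cross term vanishes since \<open>ip H x (g x)\<close> is purely imaginary. The sign
  of \<open>h\<close> is irrelevant, which gives contractions in both time directions.\<close>

lemma resolvent_norm:
  assumes "x \<in> D"
  shows "(hnorm H (x - complex_of_real h *\<^sub>C g x))\<^sup>2 = (hnorm H x)\<^sup>2 + h\<^sup>2 * (hnorm H (g x))\<^sup>2"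
  using assms Re_ip_g[OF assms]
  by (simp add: hnorm_diff_power2 D_carrier g_carrier ip_scale_right hnorm_scale power_mult_distrib)

lemma resolvent_le:
  assumes "x \<in> D"
  shows "hnorm H x \<le> hnorm H (x - complex_of_real h *\<^sub>C g x)"
  by (rule power2_le_imp_le) (use assms in \<open>simp_all add: resolvent_norm hnorm_nonneg D_carrier g_carrier\<close>)

text \<open>Adjoints are closed: the skewness relation against a fixed \<open>f \<in> D\<close>
  passes to the limit, and \<open>maximal\<close> turns the limiting relation into membership in
  \<open>D\<close>.\<close>

lemma g_closed:
  assumes s: "range s \<subseteq> D" and x: "x \<in> carrier H" "y \<in> carrier H"
    and lim: "hconverges H s x" "hconverges H (\<lambda>n. g (s n)) y"
  shows "x \<in> D \<and> g x = y"
proof (rule maximal[OF x])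
  fix f assume f: "f \<in> D"
  have sD: "s n \<in> D" for n using s by auto
  have "(\<lambda>n. ip H (g f) (s n)) \<longlonglongrightarrow> ip H (g f) x"
    using s x lim f by (intro hconverges_ip_right) (auto simp: D_carrier g_carrier)
  moreover have "(\<lambda>n. - ip H f (g (s n))) \<longlonglongrightarrow> - ip H f y"
    using sD x lim f by (intro tendsto_minus hconverges_ip_right) (auto simp: D_carrier g_carrier)
  moreover have "ip H (g f) (s n) = - ip H f (g (s n))" for n
    by (rule skew[OF f sD])
  ultimately show "ip H (g f) x = - ip H f y"
    by (simp add: LIMSEQ_unique)
qed

text \<open>The range of \<open>1 - h g\<close> is closed because \<open>1 - h g\<close> does not
  shrink norms and \<open>g\<close> is closed. A vector \<open>w\<close> orthogonal to the range
  would be an eigenvector of \<open>g\<close> with the real eigenvalue \<open>- 1/h\<close>, which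
  skewness excludes.\<close>

lemma resolvent_surj:
  assumes h: "h \<noteq> 0" and u: "u \<in> carrier H"
  shows "\<exists>x\<in>D. x - complex_of_real h *\<^sub>C g x = u"
proof -
  define r where "r x = x - complex_of_real h *\<^sub>C g x" for x
  define M where "M = r ` D"
  have r_diff: "r x - r y = r (x - y)" if "x \<in> D" "y \<in> D" for x y
    using that by (simp add: r_def g_diff complex_vector.scale_right_diff_distrib)
  have r_add: "r x + r y = r (x + y)" if "x \<in> D" "y \<in> D" for x y
    using that by (simp add: r_def g_add complex_vector.scale_right_distrib)
  have r_scale: "c *\<^sub>C r x = r (c *\<^sub>C x)" if "x \<in> D" for x c
    using that by (simp add: r_def g_scale complex_vector.scale_right_diff_distrib scaleC_scaleC
        mult.commute)
  have rc: "r x \<in> carrier H" if "x \<in> D" for x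
    using that by (simp add: r_def D_carrier g_carrier)
  have r0: "r 0 = 0" using r_diff[OF D_zero D_zero] by simp
  have subM: "complex_vector.subspace M"
    unfolding complex_vector.subspace_def M_def
    using D_zero r0 by (force simp: r_add r_scale D_add D_scale)
  have M: "M \<subseteq> carrier H" by (auto simp: M_def rc)
  obtain s y where s: "range s \<subseteq> M" "y \<in> carrier H" "hconverges H s y"
      "\<And>z. z \<in> M \<Longrightarrow> ip H z (u - y) = 0"
    using projection[OF subM M u] by metis
  have "\<forall>n. \<exists>x\<in>D. s n = r x" using s(1) by (auto simp: M_def)
  then obtain p where p: "\<And>n. p n \<in> D" "\<And>n. s n = r (p n)" by metis
  have sc: "s n \<in> carrier H" for n using s(1) M by auto
  \<comment> \<open>Preimages of a Cauchy sequence in the range are again Cauchy, so the projection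
    of \<open>u\<close> onto the closure of the range has a preimage.\<close>
  have le: "hnorm H (p m - p n) \<le> hnorm H (s m - s n)" for m n
    using resolvent_le[of "p m - p n" h] p by (simp add: r_diff D_diff flip: r_def)
  have "hCauchy H s" by (rule hconverges_imp_hCauchy) (use s M in auto)
  then have "hCauchy H p" unfolding hCauchy_def by (meson le le_less_trans)
  then obtain x where x: "x \<in> carrier H" "hconverges H p x"
    using complete[of p] p(1) D_carrier by blast
  have "hconverges H (\<lambda>n. complex_of_real (1/h) *\<^sub>C (p n - s n)) (complex_of_real (1/h) *\<^sub>C (x - y))"
    using p(1) x s M sc D_carrier by (intro hconverges_scale hconverges_diff) auto
  moreover have "complex_of_real (1/h) *\<^sub>C (p n - s n) = g (p n)" for n
    using h by (simp add: p(2) r_def scaleC_scaleC scaleC_one)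
  ultimately have "hconverges H (\<lambda>n. g (p n)) (complex_of_real (1/h) *\<^sub>C (x - y))" by simp
  then have "x \<in> D \<and> g x = complex_of_real (1/h) *\<^sub>C (x - y)"
    using p(1) x s(2) by (intro g_closed) auto
  then have x': "x \<in> D" "r x = y"
    using h by (auto simp: r_def scaleC_scaleC scaleC_one)
  define w where "w = u - y"
  have w: "w \<in> carrier H" using u s(2) by (simp add: w_def)
  \<comment> \<open>Orthogonality to the range says that the adjoint of \<open>g\<close> maps
    \<open>w\<close> to \<open>w\<close> divided by \<open>h\<close>; by maximality \<open>w\<close>
    is in \<open>D\<close>.\<close>
  have "w \<in> D \<and> g w = complex_of_real (- 1/h) *\<^sub>C w"
  proof (rule maximal)
    fix f assume f: "f \<in> D"
    have "ip H (r f) w = 0" using s(4)[of "r f"] f by (simp add: M_def w_def)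
    then have "ip H f w = complex_of_real h * ip H (g f) w"
      using f w by (simp add: r_def ip_simps D_carrier g_carrier)
    then show "ip H (g f) w = - ip H f (complex_of_real (- 1/h) *\<^sub>C w)"
      using h f w by (simp add: ip_minus_right ip_scale_right D_carrier)
  qed (use w in auto)
  then have "Re (ip H w (complex_of_real (- 1/h) *\<^sub>C w)) = 0" using Re_ip_g[of w] by simp
  then have "Re (ip H w w) = 0" using h w by (simp add: ip_minus_right ip_scale_right Re_divide_of_real)
  then have "w = 0" using ip_pos[OF w] by auto
  then show ?thesis using x' by (auto simp: w_def r_def)
qed

lemma resolvent_inj:
  assumes "x \<in> D" "y \<in> D" "x - complex_of_real h *\<^sub>C g x = y - complex_of_real h *\<^sub>C g y"
  shows "x = y"
proof -
  have "x - y - complex_of_real h *\<^sub>C g (x - y) = 0"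
    using assms by (simp add: g_diff complex_vector.scale_right_diff_distrib algebra_simps)
  then have "hnorm H (x - y) \<le> 0"
    using resolvent_le[of "x - y" h] assms by (simp add: D_diff)
  then show ?thesis
    using hnorm_nonneg[of "x - y"] hnorm_eq_0[of "x - y"] assms by (simp add: D_carrier)
qed

text \<open>\<open>E h\<close> is the implicit Euler step \<open>(1 - h g)\<^sup>-\<^sup>1\<close>.\<close>

definition E :: "real \<Rightarrow> 'a \<Rightarrow> 'a"
  where "E h u = (if h = 0 then u else THE x. x \<in> D \<and> x - complex_of_real h *\<^sub>C g x = u)"

text \<open>At \<open>h = 0\<close> the resolvent equation has a solution in \<open>D\<close> only
  for \<open>u \<in> D\<close>; the case distinction in \<open>E\<close> makes the zero step the
  identity on the whole carrier.\<close>

lemma E_0 [simp]: "E 0 u = u"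
  by (simp add: E_def)

lemma E_resolvent:
  assumes "h \<noteq> 0" "u \<in> carrier H"
  shows "E h u \<in> D" "E h u - complex_of_real h *\<^sub>C g (E h u) = u"
proof -
  have "\<exists>!x. x \<in> D \<and> x - complex_of_real h *\<^sub>C g x = u"
    using resolvent_surj[OF assms] resolvent_inj by blast
  from theI'[OF this] show "E h u \<in> D" "E h u - complex_of_real h *\<^sub>C g (E h u) = u"
    using assms by (simp_all add: E_def)
qed

lemma E_eqI:
  assumes "x \<in> D" "x - complex_of_real h *\<^sub>C g x = u"
  shows "E h u = x"
proof (cases "h = 0")
  case False
  have "u \<in> carrier H" using assms by (auto simp: D_carrier g_carrier)
  from E_resolvent[OF False this] show ?thesis using assms resolvent_inj by blast
qed (use assms in simp)

lemma E_carrier: "u \<in> carrier H \<Longrightarrow> E h u \<in> carrier H"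
  using E_resolvent[of h u] D_carrier by (cases "h = 0") auto

text \<open>Since \<open>g\<close> is skew, the adjoint of \<open>1 - h g\<close> is
  \<open>1 + h g\<close>, and inversion preserves this relation.\<close>

lemma E_adjoint:
  assumes "u \<in> carrier H" "v \<in> carrier H"
  shows "ip H (E h u) v = ip H u (E (- h) v)"
proof (cases "h = 0")
  case False
  define x y where "x = E h u" and "y = E (- h) v"
  have x: "x \<in> D" "u = x - complex_of_real h *\<^sub>C g x"
    using E_resolvent[OF False assms(1)] by (simp_all add: x_def)
  have y: "y \<in> D" "v = y - complex_of_real (- h) *\<^sub>C g y"
    using E_resolvent[of "- h" v] False assms(2) by (simp_all add: y_def)
  have "ip H x (y - complex_of_real (- h) *\<^sub>C g y) = ip H (x - complex_of_real h *\<^sub>C g x) y"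
    using x(1) y(1) skew[OF x(1) y(1)] by (simp add: ip_simps D_carrier g_carrier)
  then show ?thesis unfolding x_def[symmetric] y_def[symmetric] using x y by simp
qed simp

lemma E_contraction: "contraction (E h)"
  unfolding contraction_def
proof (intro conjI ballI)
  fix x assume x: "x \<in> carrier H"
  show "E h x \<in> carrier H" using x by (rule E_carrier)
  show "hnorm H (E h x) \<le> hnorm H x"
    using E_resolvent[OF _ x, of h] resolvent_le[of "E h x" h] by (cases "h = 0") auto
  fix y assume y: "y \<in> carrier H"
  show "E h (x - y) = E h x - E h y"
    by (rule linear_if_adjoint(2)[where F' = "E (- h)"]) (auto simp: E_carrier E_adjoint x y)
qed

lemmas E_simps = contractionD[OF E_contraction]

lemma E_g:
  assumes x: "x \<in> D"
  shows "E h x \<in> D" "g (E h x) = E h (g x)"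
proof -
  have "E h x \<in> D \<and> g (E h x) = E h (g x)"
  proof (cases "h = 0")
    case False
    define v where "v = E h x"
    have v: "v \<in> D" "v - complex_of_real h *\<^sub>C g v = x"
      using E_resolvent[OF False D_carrier[OF x]] by (auto simp: v_def)
    \<comment> \<open>The resolvent equation expresses \<open>g v\<close> through \<open>v\<close>
      and \<open>x\<close>, both in \<open>D\<close>; this is why \<open>g\<close> may be applied
      once more.\<close>
    have "g v = complex_of_real (1/h) *\<^sub>C (v - x)"
      using False by (simp add: scaleC_scaleC scaleC_one flip: v(2))
    then have gv: "g v \<in> D" using v x by (simp add: D_diff D_scale)
    have "g v - complex_of_real h *\<^sub>C g (g v) = g (v - complex_of_real h *\<^sub>C g v)"
      using v(1) gv by (simp add: g_diff g_scale D_scale)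
    then have "E h (g x) = g v" using gv v by (intro E_eqI) auto
    then show ?thesis using v by (simp add: v_def)
  qed (use x in simp)
  then show "E h x \<in> D" "g (E h x) = E h (g x)" by auto
qed

text \<open>The first-order expansion of the resolvent with exact remainder; applying it again to
  \<open>g x\<close> gives the second-order one.\<close>

lemma E_expand:
  assumes "x \<in> D"
  shows "E h x = x + complex_of_real h *\<^sub>C E h (g x)"
proof (cases "h = 0")
  case False
  have "E h x = x + complex_of_real h *\<^sub>C g (E h x)"
    using E_resolvent(2)[OF False D_carrier[OF assms]] by (simp add: algebra_simps)
  then show ?thesis by (simp only: E_g(2)[OF assms])
qed simp

lemma E_commute:
  assumes x: "x \<in> carrier H"
  shows "E s (E t x) = E t (E s x)"
proof (cases "s = 0 \<or> t = 0")
  case False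
  then have s: "s \<noteq> 0" and t: "t \<noteq> 0" by auto
  define v where "v = E t x"
  have v: "v \<in> D" "v - complex_of_real t *\<^sub>C g v = x" using E_resolvent[OF t x] by (auto simp: v_def)
  define y where "y = E s v"
  have y: "y \<in> D" "y - complex_of_real s *\<^sub>C g y = v"
    using E_resolvent[OF s D_carrier[OF v(1)]] by (auto simp: y_def)
  have "g y = complex_of_real (1/s) *\<^sub>C (y - v)"
    using s by (simp add: scaleC_scaleC scaleC_one flip: y(2))
  then have gy: "g y \<in> D" using v y by (simp add: D_diff D_scale)
  \<comment> \<open>\<open>z\<close> is \<open>(1 - t g) y\<close>. As \<open>g y \<in> D\<close>,
    the factors \<open>1 - s g\<close> and \<open>1 - t g\<close> may be interchanged at
    \<open>y\<close>, so \<open>z\<close> solves the resolvent equation for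
    \<open>E s x\<close>.\<close>
  define z where "z = y - complex_of_real t *\<^sub>C g y"
  have z: "z \<in> D" using y gy by (simp add: z_def D_diff D_scale)
  have "x = z - complex_of_real s *\<^sub>C g z"
    unfolding v(2)[symmetric] y(2)[symmetric] z_def using y(1) gy
    by (simp add: g_diff g_scale D_scale complex_vector.scale_right_diff_distrib
        scaleC_scaleC mult.commute algebra_simps)
  then have "E s x = z" using z by (intro E_eqI) auto
  moreover have "E t z = y" using y(1) by (intro E_eqI) (auto simp: z_def)
  ultimately show ?thesis by (simp add: y_def v_def)
qed auto

lemma hnorm_E_diff_le:
  assumes "x \<in> D"
  shows "hnorm H (E h x - x) \<le> \<bar>h\<bar> * hnorm H (g x)"
  using assms E_simps(2)[of "g x" h] by (simp add: E_expand hnorm_scale g_carrier E_carrier mult_left_mono)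

text \<open>Strong convergence of \<open>E h\<close> to the identity, in the form used for
  smoothing: a nonzero \<open>h\<close> puts \<open>E h x\<close> into \<open>D\<close> while
  staying close to \<open>x\<close>.\<close>

lemma E_tendsto:
  assumes x: "x \<in> carrier H" and e: "e > 0"
  shows "\<exists>h. h \<noteq> 0 \<and> hnorm H (E h x - x) < e"
proof -
  have "e / 3 > 0" using e by simp
  then obtain z where z: "z \<in> D" "hnorm H (x - z) < e / 3"
    using dense_D x unfolding dense_in_def by blast
  have zc: "z \<in> carrier H" using z D_carrier by auto
  \<comment> \<open>The summand \<open>1\<close> keeps the quotient meaningful when
    \<open>g z = 0\<close>.\<close>
  define h where "h = e / (3 * (hnorm H (g z) + 1))"
  have pos: "hnorm H (g z) \<ge> 0" using z by (simp add: hnorm_nonneg g_carrier)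
  then have h: "h > 0" using e by (simp add: h_def)
  have "\<bar>h\<bar> * hnorm H (g z) < e / 3"
    using pos e h by (simp add: h_def field_simps)
  then have 1: "hnorm H (E h z - z) < e / 3" using hnorm_E_diff_le[OF z(1), of h] by simp
  have "hnorm H (E h x - x) \<le> hnorm H (E h x - E h z) + hnorm H (E h z - x)"
    using x zc by (intro hnorm_dist_triangle) (auto simp: E_simps)
  also have "hnorm H (E h z - x) \<le> hnorm H (E h z - z) + hnorm H (z - x)"
    using x zc by (intro hnorm_dist_triangle) (auto simp: E_simps)
  finally have "hnorm H (E h x - x) < e"
    using 1 z(2) E_simps(4)[OF x zc, of h] hnorm_minus_commute[OF x zc] by simp
  then show ?thesis using h by (intro exI[of _ h]) auto
qed

definition D2 :: "'a set"
  where "D2 = {x \<in> D. g x \<in> D}"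

text \<open>Smoothing by \<open>E h\<close> commutes with \<open>g\<close>, so
  \<open>g (E h x) = E h (g x)\<close> approximates \<open>g x\<close>. Only
  \<open>g (x - z)\<close> has to be small, because \<open>W t - 1\<close> on \<open>D\<close> is
  bounded by \<open>\<bar>t\<bar>\<close> times the norm of \<open>g\<close>.\<close>

lemma D2_core:
  assumes x: "x \<in> D" and e: "e > 0"
  shows "\<exists>z\<in>D2. hnorm H (g (x - z)) < e"
proof -
  obtain h where h: "h \<noteq> 0" "hnorm H (E h (g x) - g x) < e"
    using E_tendsto[OF g_carrier[OF x] e] by blast
  have "E h x \<in> D2" using E_g[OF x, of h] E_resolvent(1)[OF h(1) g_carrier[OF x]] by (simp add: D2_def)
  moreover have "hnorm H (g (x - E h x)) < e"
    using h x E_g[OF x, of h] hnorm_minus_commute[of "g x" "E h (g x)"]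
    by (simp add: g_diff E_simps g_carrier)
  ultimately show ?thesis by blast
qed

lemma dense_D2: "dense_in H D2"
  unfolding dense_in_def
proof (intro conjI ballI allI impI)
  show "D2 \<subseteq> carrier H" by (auto simp: D2_def D_carrier)
  fix x and e :: real assume x: "x \<in> carrier H" and "e > 0"
  then have e2: "e / 2 > 0" by simp
  then obtain z where z: "z \<in> D" "hnorm H (x - z) < e / 2"
    using dense_D x unfolding dense_in_def by blast
  have zc: "z \<in> carrier H" using z D_carrier by auto
  obtain h where h: "h \<noteq> 0" "hnorm H (E h z - z) < e / 2" using E_tendsto[OF zc e2] by blast
  have "E h z \<in> D2"
    using E_g[OF z(1), of h] E_resolvent(1)[OF h(1) g_carrier[OF z(1)]] by (simp add: D2_def)
  moreover have "hnorm H (x - E h z) < e"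
    using hnorm_dist_triangle[of x z "E h z"] hnorm_minus_commute[of "E h z" z] h z x zc
    by (simp add: E_simps)
  ultimately show "\<exists>y\<in>D2. hnorm H (x - y) < e" by blast
qed

end

subsection \<open>The unitary group as a limit of implicit Euler steps\<close>

lemma op_graph_eqI: "(\<And>x y. R x y \<longleftrightarrow> T x = Some y) \<Longrightarrow> op_graph R = T"
proof
  fix x assume R: "\<And>x y. R x y \<longleftrightarrow> T x = Some y"
  then have "R x = (\<lambda>y. T x = Some y)" by blast
  then show "op_graph R x = T x" by (cases "T x") (auto simp: op_graph_def)
qed

context skew_adjoint
begin

lemma D2_D: "x \<in> D2 \<Longrightarrow> x \<in> D" "x \<in> D2 \<Longrightarrow> g x \<in> D"
  by (auto simp: D2_def)

lemma D2_carrier: "x \<in> D2 \<Longrightarrow> x \<in> carrier H"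
  by (simp add: D2_D D_carrier)

lemma E_expand2:
  assumes "x \<in> D2"
  shows "E h x = x + complex_of_real h *\<^sub>C g x + complex_of_real (h\<^sup>2) *\<^sub>C E h (g (g x))"
  using E_expand[OF D2_D(1)[OF assms], of h] E_expand[OF D2_D(2)[OF assms], of h]
  by (simp add: complex_vector.scale_right_distrib scaleC_scaleC power2_eq_square)

text \<open>Both sides have the same expansion up to first order; what remains are second-order
  terms in which only contractions act on \<open>g (g x)\<close>.\<close>

lemma E_add_diff_le:
  assumes x: "x \<in> D2"
  shows "hnorm H (E (s + t) x - E s (E t x)) \<le> 2 * (\<bar>s\<bar> + \<bar>t\<bar>)\<^sup>2 * hnorm H (g (g x))"
proof -
  define w where "w = g (g x)"
  define a b c where "a = E t w" and "b = E (s + t) w" and "c = E s a"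
  note xD = D2_D[OF x]
  have w: "w \<in> carrier H" using xD by (simp add: w_def g_carrier)
  have abc: "a \<in> carrier H" "b \<in> carrier H" "c \<in> carrier H"
    using w by (simp_all add: a_def b_def c_def E_simps)
  have n: "hnorm H a \<le> hnorm H w" "hnorm H b \<le> hnorm H w" "hnorm H c \<le> hnorm H w"
    using w E_simps(2)[of w] E_simps(2)[of a s] abc(1) order_trans
    by (auto simp: a_def b_def c_def)
  have y: "E t x \<in> D2" "g (E t x) = E t (g x)" "g (g (E t x)) = a"
    using xD E_g by (simp_all add: D2_def a_def w_def)
  have 1: "E s (E t x) = E t x + complex_of_real s *\<^sub>C E t (g x) + complex_of_real (s\<^sup>2) *\<^sub>C c"
    using E_expand2[OF y(1), of s] y by (simp add: c_def)
  have 2: "E t x = x + complex_of_real t *\<^sub>C g x + complex_of_real (t\<^sup>2) *\<^sub>C a"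
    using E_expand2[OF x, of t] by (simp add: a_def w_def)
  have 3: "E t (g x) = g x + complex_of_real t *\<^sub>C a"
    using E_expand[OF xD(2), of t] by (simp add: a_def w_def)
  have "E s (E t x) = x + complex_of_real t *\<^sub>C g x + complex_of_real (t\<^sup>2) *\<^sub>C a
      + complex_of_real s *\<^sub>C (g x + complex_of_real t *\<^sub>C a) + complex_of_real (s\<^sup>2) *\<^sub>C c"
    unfolding 1 unfolding 2 3 ..
  \<comment> \<open>The terms in \<open>x\<close> and \<open>g x\<close> cancel here. The mixed
    coefficient \<open>s * t\<close> comes from expanding \<open>E t (g x)\<close> inside the
    first-order term of \<open>E s\<close>.\<close>
  then have "E (s + t) x - E s (E t x) = complex_of_real ((s + t)\<^sup>2) *\<^sub>C b
      - (complex_of_real (t\<^sup>2 + s * t) *\<^sub>C a + complex_of_real (s\<^sup>2) *\<^sub>C c)"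
    using E_expand2[OF x, of "s + t"]
    by (simp add: complex_vector.scale_right_distrib complex_vector.scale_left_distrib scaleC_scaleC
        algebra_simps flip: b_def w_def)
  also have "hnorm H \<dots> \<le> hnorm H (complex_of_real ((s + t)\<^sup>2) *\<^sub>C b) +
      (hnorm H (complex_of_real (t\<^sup>2 + s * t) *\<^sub>C a) + hnorm H (complex_of_real (s\<^sup>2) *\<^sub>C c))"
    using abc by (intro order_trans[OF hnorm_triangle_diff] add_left_mono hnorm_triangle) auto
  also have "\<dots> = (s + t)\<^sup>2 * hnorm H b + (\<bar>t\<^sup>2 + s * t\<bar> * hnorm H a + s\<^sup>2 * hnorm H c)"
    using abc by (simp only: hnorm_scale norm_of_real) simp
  also have "\<dots> \<le> (s + t)\<^sup>2 * hnorm H w + (\<bar>t\<^sup>2 + s * t\<bar> * hnorm H w + s\<^sup>2 * hnorm H w)"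
    using n by (intro add_mono mult_left_mono) auto
  also have "\<dots> = ((s + t)\<^sup>2 + \<bar>t\<^sup>2 + s * t\<bar> + s\<^sup>2) * hnorm H w"
    by (simp add: algebra_simps)
  \<comment> \<open>The \<open>2\<close> counts two contributions, \<open>b\<close> on one side,
    \<open>a\<close> and \<open>c\<close> together on the other, each at most the square of
    \<open>\<bar>s\<bar> + \<bar>t\<bar>\<close>.\<close>
  also have "\<dots> \<le> 2 * (\<bar>s\<bar> + \<bar>t\<bar>)\<^sup>2 * hnorm H w"
  proof (rule mult_right_mono)
    have "(s + t)\<^sup>2 \<le> (\<bar>s\<bar> + \<bar>t\<bar>)\<^sup>2"
      using abs_triangle_ineq[of s t] by (intro power2_le_iff_abs_le[THEN iffD2]) auto
    moreover have "\<bar>t\<^sup>2 + s * t\<bar> \<le> t\<^sup>2 + \<bar>s\<bar> * \<bar>t\<bar>"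
      using abs_triangle_ineq[of "t\<^sup>2" "s * t"] by (simp add: abs_mult)
    moreover have "t\<^sup>2 + \<bar>s\<bar> * \<bar>t\<bar> + s\<^sup>2 \<le> (\<bar>s\<bar> + \<bar>t\<bar>)\<^sup>2"
      by (simp add: power2_sum)
    ultimately show "(s + t)\<^sup>2 + \<bar>t\<^sup>2 + s * t\<bar> + s\<^sup>2 \<le> 2 * (\<bar>s\<bar> + \<bar>t\<bar>)\<^sup>2" by linarith
  qed (use w in \<open>simp add: hnorm_nonneg\<close>)
  finally show ?thesis by (simp add: w_def)
qed

text \<open>Dyadic step numbers make successive approximations comparable step by step: each step of
  length \<open>2 * h\<close> is replaced by two of length \<open>h\<close>.\<close>

definition P :: "real \<Rightarrow> nat \<Rightarrow> 'a \<Rightarrow> 'a"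
  where "P t k = E (t / 2 ^ k) ^^ (2 ^ k)"

lemma P_contraction: "contraction (P t k)"
  unfolding P_def by (intro contraction_funpow E_contraction)

lemmas P_simps = contractionD[OF P_contraction]

lemma funpow_E_adjoint:
  assumes "x \<in> carrier H" "y \<in> carrier H"
  shows "ip H ((E h ^^ n) x) y = ip H x ((E (- h) ^^ n) y)"
  using assms(1)
proof (induction n arbitrary: x)
  case (Suc n)
  have c: "(E (- h) ^^ n) y \<in> carrier H"
    using assms(2) contractionD(1)[OF contraction_funpow[OF E_contraction]] by blast
  have "ip H ((E h ^^ Suc n) x) y = ip H ((E h ^^ n) (E h x)) y"
    by (simp only: funpow_Suc_right comp_apply)
  also have "\<dots> = ip H (E h x) ((E (- h) ^^ n) y)"
    using Suc E_carrier by simp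
  finally show ?case using E_adjoint[OF Suc.prems c] by simp
qed simp

lemma P_adjoint: "x \<in> carrier H \<Longrightarrow> y \<in> carrier H \<Longrightarrow> ip H (P t k x) y = ip H x (P (- t) k y)"
  by (simp add: P_def funpow_E_adjoint)

lemma P_Suc_diff_le:
  assumes x: "x \<in> D2"
  shows "hnorm H (P t k x - P t (Suc k) x) \<le> 2 * t\<^sup>2 * hnorm H (g (g x)) / 2 ^ k"
proof -
  define h where "h = t / 2 ^ Suc k"
  have xc: "x \<in> carrier H" using x by (rule D2_carrier)
  \<comment> \<open>The finer approximation is regrouped into \<open>2 ^ k\<close> double steps, so
    that both approximations become powers with the same exponent.\<close>
  have "((\<lambda>x. E h (E h x)) ^^ (2 ^ k)) x = (E h ^^ (2 ^ k)) ((E h ^^ (2 ^ k)) x)"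
    by (rule funpow_comp_commute[of "E h" "E h", OF E_contraction E_contraction refl xc])
  also have "\<dots> = P t (Suc k) x"
    by (simp only: P_def h_def power_Suc mult_2 funpow_add comp_apply)
  finally have "hnorm H (P t k x - P t (Suc k) x) =
      hnorm H ((E (h + h) ^^ (2 ^ k)) x - ((\<lambda>x. E h (E h x)) ^^ (2 ^ k)) x)"
    by (simp add: P_def h_def)
  also have "\<dots> \<le> real (2 ^ k) * hnorm H (E (h + h) x - E h (E h x))"
    by (rule funpow_diff_le[OF E_contraction contraction_comp[OF E_contraction E_contraction] _ xc])
      (simp add: E_commute[of _ "2 * h"] E_carrier)
  also have "\<dots> \<le> real (2 ^ k) * (2 * (\<bar>h\<bar> + \<bar>h\<bar>)\<^sup>2 * hnorm H (g (g x)))"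
    by (intro mult_left_mono E_add_diff_le[OF x]) simp
  also have "\<bar>h\<bar> + \<bar>h\<bar> = \<bar>t\<bar> / 2 ^ k" by (simp add: h_def)
  finally show ?thesis by (simp add: power_divide power2_eq_square)
qed

lemma P_diff_le:
  assumes x: "x \<in> D2" and "k \<le> l"
  shows "hnorm H (P t k x - P t l x) \<le> 4 * t\<^sup>2 * hnorm H (g (g x)) / 2 ^ k"
proof -
  define C where "C = 4 * t\<^sup>2 * hnorm H (g (g x)) / 2 ^ k"
  have xc: "x \<in> carrier H" using x by (rule D2_carrier)
  \<comment> \<open>\<open>C\<close> is the full geometric series of the bounds in
    \<open>P_Suc_diff_le\<close> starting at \<open>k\<close>, and the factor
    \<open>1 - 1 / 2 ^ m\<close> is the share of its first \<open>m\<close> terms.\<close>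
  have "hnorm H (P t k x - P t (k + m) x) \<le> C * (1 - 1 / 2 ^ m)" for m
  proof (induction m)
    case (Suc m)
    have "hnorm H (P t k x - P t (k + Suc m) x) \<le>
        hnorm H (P t k x - P t (k + m) x) + hnorm H (P t (k + m) x - P t (Suc (k + m)) x)"
      using xc hnorm_dist_triangle[of "P t k x" "P t (k + m) x" "P t (k + Suc m) x"]
      by (simp add: P_simps)
    also have "\<dots> \<le> C * (1 - 1 / 2 ^ m) + C / 2 * (1 / 2 ^ m)"
    proof (rule add_mono)
      have "C / 2 * (1 / 2 ^ m) = 2 * t\<^sup>2 * hnorm H (g (g x)) / 2 ^ (k + m)"
        by (simp add: C_def power_add)
      then show "hnorm H (P t (k + m) x - P t (Suc (k + m)) x) \<le> C / 2 * (1 / 2 ^ m)"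
        using P_Suc_diff_le[OF x, of t "k + m"] by simp
    qed (rule Suc)
    finally show ?case by (simp add: algebra_simps)
  qed simp
  from this[of "l - k"] have "hnorm H (P t k x - P t l x) \<le> C * (1 - 1 / 2 ^ (l - k))"
    using \<open>k \<le> l\<close> by simp
  also have "\<dots> \<le> C * 1"
    using D2_D[OF x] by (intro mult_left_mono) (simp_all add: C_def hnorm_nonneg g_carrier)
  finally show ?thesis by (simp add: C_def)
qed

lemma P_converges:
  assumes x: "x \<in> carrier H"
  shows "\<exists>y\<in>carrier H. hconverges H (\<lambda>k. P t k x) y"
proof (rule complete)
  show "range (\<lambda>k. P t k x) \<subseteq> carrier H" using x by (auto simp: P_simps)
  show "hCauchy H (\<lambda>k. P t k x)" unfolding hCauchy_def
  proof (intro allI impI)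
    fix e :: real assume "e > 0"
    \<comment> \<open>Four distances are summed: replacing \<open>x\<close> by \<open>z\<close> at
      both ends, and passing from \<open>m\<close> to \<open>n\<close> through \<open>N\<close>,
      since \<open>P_diff_le\<close> compares a coarser with a finer approximation.\<close>
    then have e4: "e / 4 > 0" by simp
    then obtain z where z: "z \<in> D2" "hnorm H (x - z) < e / 4"
      using dense_D2 x unfolding dense_in_def by blast
    have zc: "z \<in> carrier H" using z D2_carrier by auto
    define C where "C = 4 * t\<^sup>2 * hnorm H (g (g z))"
    have C0: "C \<ge> 0" using D2_D[OF z(1)] by (simp add: C_def hnorm_nonneg g_carrier)
    have "(\<lambda>n. C * (1 / 2) ^ n) \<longlonglongrightarrow> 0"
      by (intro tendsto_mult_right_zero LIMSEQ_power_zero) simp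
    from LIMSEQ_D[OF this e4] obtain N where "norm (C * (1 / 2) ^ N - 0) < e / 4"
      by blast
    then have N: "C / 2 ^ N < e / 4" using C0 by (simp add: power_divide abs_mult)
    have lt: "hnorm H (P t N z - P t n z) < e / 4" if "n \<ge> N" for n
      using P_diff_le[OF z(1) that, of t] N by (simp add: C_def)
    have "hnorm H (P t m x - P t n x) < e" if m: "m \<ge> N" and n: "n \<ge> N" for m n
    proof -
      have c: "P t j u \<in> carrier H" if "u \<in> carrier H" for j u using that by (simp add: P_simps)
      have "hnorm H (P t m x - P t n x) \<le> hnorm H (P t m x - P t m z) + hnorm H (P t m z - P t n x)"
        using x zc c by (intro hnorm_dist_triangle) auto
      also have "hnorm H (P t m z - P t n x) \<le> hnorm H (P t m z - P t N z) + hnorm H (P t N z - P t n x)"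
        using x zc c by (intro hnorm_dist_triangle) auto
      also have "hnorm H (P t N z - P t n x) \<le> hnorm H (P t N z - P t n z) + hnorm H (P t n z - P t n x)"
        using x zc c by (intro hnorm_dist_triangle) auto
      also have "hnorm H (P t n z - P t n x) \<le> hnorm H (x - z)"
        using x zc P_simps(4)[of z x t n] hnorm_minus_commute[of x z] by simp
      also have "hnorm H (P t m x - P t m z) \<le> hnorm H (x - z)"
        using x zc P_simps(4) by simp
      also have "hnorm H (P t m z - P t N z) = hnorm H (P t N z - P t m z)"
        using c zc by (intro hnorm_minus_commute) auto
      finally show ?thesis using lt[OF m] lt[OF n] z(2) by simp
    qed
    then show "\<exists>N. \<forall>m\<ge>N. \<forall>n\<ge>N. hnorm H (P t m x - P t n x) < e" by blast
  qed
qed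

section \<open>The limit group and its generator\<close>

definition W :: "real \<Rightarrow> 'a \<Rightarrow> 'a"
  where "W t x = (SOME y. y \<in> carrier H \<and> hconverges H (\<lambda>k. P t k x) y)"

lemma W_lim:
  assumes "x \<in> carrier H"
  shows "W t x \<in> carrier H" "hconverges H (\<lambda>k. P t k x) (W t x)"
proof -
  have "\<exists>y. y \<in> carrier H \<and> hconverges H (\<lambda>k. P t k x) y"
    using P_converges[OF assms] by blast
  from someI_ex[OF this] show "W t x \<in> carrier H" "hconverges H (\<lambda>k. P t k x) (W t x)"
    by (simp_all add: W_def)
qed

text \<open>The relation passes to the limit from the Euler products. It supplies linearity of
  \<open>W t\<close> at once, and isometry as soon as the group law shows that
  \<open>W (- t)\<close> is the inverse.\<close>

lemma W_adjoint:
  assumes x: "x \<in> carrier H" and y: "y \<in> carrier H"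
  shows "ip H (W t x) y = ip H x (W (- t) y)"
proof (rule LIMSEQ_unique)
  show "(\<lambda>k. ip H (P t k x) y) \<longlonglongrightarrow> ip H (W t x) y"
    using x y by (intro hconverges_ip_left W_lim) (auto simp: P_simps)
  show "(\<lambda>k. ip H (P t k x) y) \<longlonglongrightarrow> ip H x (W (- t) y)"
    unfolding P_adjoint[OF x y]
    using x y by (intro hconverges_ip_right W_lim) (auto simp: P_simps)
qed

lemmas W_linear = linear_if_adjoint[of "W t" "W (- t)" for t, OF W_lim(1) W_lim(1) W_adjoint]

lemma W_contraction: "contraction (W t)"
  unfolding contraction_def
proof (intro conjI ballI)
  fix x assume x: "x \<in> carrier H"
  show "W t x \<in> carrier H" using x by (rule W_lim)
  have "(\<lambda>k. hnorm H (P t k x)) \<longlonglongrightarrow> hnorm H (W t x)"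
    using x by (intro hconverges_hnorm W_lim) (auto simp: P_simps)
  then show "hnorm H (W t x) \<le> hnorm H x"
    using x by (rule_tac LIMSEQ_le_const2) (auto simp: P_simps)
qed (simp_all add: W_linear)

lemmas W_simps = contractionD[OF W_contraction]

lemma W_diff_le:
  assumes x: "x \<in> carrier H" "y \<in> carrier H" and le: "\<And>k. hnorm H (P t k x - y) \<le> C"
  shows "hnorm H (W t x - y) \<le> C"
proof (rule LIMSEQ_le_const2)
  have "hconverges H (\<lambda>k. P t k x - y) (W t x - y)"
    using W_lim(2)[OF x(1), of t] by (simp add: hconverges_def)
  then show "(\<lambda>k. hnorm H (P t k x - y)) \<longlonglongrightarrow> hnorm H (W t x - y)"
    using x W_lim(1) by (intro hconverges_hnorm) (auto simp: P_simps)
qed (use le in auto)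

lemma W_diff_E_le:
  assumes x: "x \<in> D2"
  shows "hnorm H (W t x - E t x) \<le> 4 * t\<^sup>2 * hnorm H (g (g x))"
proof (rule W_diff_le)
  fix k
  \<comment> \<open>A single Euler step is the approximation with index \<open>0\<close>, so the
    Cauchy estimate starting there measures its distance to the limit.\<close>
  have "P t 0 x = E t x" by (simp add: P_def)
  then show "hnorm H (P t k x - E t x) \<le> 4 * t\<^sup>2 * hnorm H (g (g x))"
    using P_diff_le[OF x, of 0 k t] hnorm_minus_commute[of "P t k x" "E t x"] x
    by (simp add: P_simps E_simps D2_carrier)
qed (use x in \<open>simp_all add: D2_carrier E_simps\<close>)

lemma W_diff_id_le:
  assumes x: "x \<in> D"
  shows "hnorm H (W t x - x) \<le> \<bar>t\<bar> * hnorm H (g x)"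
proof (rule W_diff_le)
  fix k
  \<comment> \<open>The identity is regarded as a power with the same exponent; the
    \<open>2 ^ k\<close> steps cancel the step length, and the bound does not depend on
    \<open>k\<close>.\<close>
  have "hnorm H (P t k x - ((\<lambda>x. x) ^^ (2 ^ k)) x) \<le> real (2 ^ k) * hnorm H (E (t / 2 ^ k) x - x)"
    unfolding P_def using x by (intro funpow_diff_le E_contraction contraction_id) (auto simp: D_carrier)
  also have "\<dots> \<le> real (2 ^ k) * (\<bar>t / 2 ^ k\<bar> * hnorm H (g x))"
    by (intro mult_left_mono hnorm_E_diff_le[OF x]) simp
  also have "((\<lambda>x. x) ^^ n) x = x" for n by (induction n) auto
  finally show "hnorm H (P t k x - x) \<le> \<bar>t\<bar> * hnorm H (g x)" by simp
qed (use x in \<open>simp_all add: D_carrier\<close>)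

lemma W_0:
  assumes "x \<in> carrier H"
  shows "W 0 x = x"
proof (rule contraction_eq_dense[OF W_contraction contraction_id dense_D _ assms])
  fix x assume x: "x \<in> D"
  have "W 0 x - x \<in> carrier H" using x by (simp add: W_simps D_carrier)
  then show "W 0 x = x"
    using W_diff_id_le[OF x, of 0] hnorm_nonneg[of "W 0 x - x"] hnorm_eq_0[of "W 0 x - x"] by simp
qed

text \<open>On \<open>D2\<close> the Euler products for \<open>s + t\<close> and for
  \<open>s\<close> after \<open>t\<close>, with equally many steps, differ by at most a constant
  over \<open>2 ^ k\<close>. No common step length is involved, so arbitrary real \<open>s\<close>
  and \<open>t\<close> are covered.\<close>

lemma W_add:
  assumes "x \<in> carrier H"
  shows "W (s + t) x = W s (W t x)"
proof (rule contraction_eq_dense[OF W_contraction contraction_comp[OF W_contraction W_contraction]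
      dense_D2 _ assms])
  fix x assume x: "x \<in> D2"
  have xc: "x \<in> carrier H" using x by (rule D2_carrier)
  define C where "C = 2 * (\<bar>s\<bar> + \<bar>t\<bar>)\<^sup>2 * hnorm H (g (g x))"
  have c: "P r k u \<in> carrier H" if "u \<in> carrier H" for r k u using that by (simp add: P_simps)
  have "hconverges H (\<lambda>k. P (s + t) k x) (W s (W t x))"
    unfolding hconverges_def
  proof (rule Lim_null_comparison)
    have "hnorm H (P (s + t) k x - W s (W t x)) \<le>
      C * (1 / 2) ^ k + (hnorm H (P t k x - W t x) + hnorm H (P s k (W t x) - W s (W t x)))" for k
    proof -
      define a b where "a = s / 2 ^ k" and "b = t / 2 ^ k"
      \<comment> \<open>Commuting resolvents allow the two blocks of steps to be interleaved, which
        reduces the comparison to a single pair of steps.\<close>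
      have 1: "P s k (P t k x) = ((\<lambda>x. E a (E b x)) ^^ (2 ^ k)) x"
        unfolding P_def a_def b_def
        by (rule funpow_comp_commute[of "E (s / 2 ^ k)" "E (t / 2 ^ k)", OF E_contraction E_contraction
              E_commute xc, symmetric])
      have 2: "P (s + t) k x = (E (a + b) ^^ (2 ^ k)) x"
        by (simp add: P_def a_def b_def add_divide_distrib)
      have "hnorm H ((E (a + b) ^^ (2 ^ k)) x - ((\<lambda>x. E a (E b x)) ^^ (2 ^ k)) x) \<le>
          real (2 ^ k) * hnorm H (E (a + b) x - E a (E b x))"
        by (rule funpow_diff_le[OF E_contraction contraction_comp[OF E_contraction E_contraction] _ xc])
          (simp add: E_commute[of _ "a + b"] E_carrier)
      also have "\<dots> \<le> real (2 ^ k) * (2 * (\<bar>a\<bar> + \<bar>b\<bar>)\<^sup>2 * hnorm H (g (g x)))"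
        by (intro mult_left_mono E_add_diff_le[OF x]) simp
      also have "\<bar>a\<bar> + \<bar>b\<bar> = (\<bar>s\<bar> + \<bar>t\<bar>) / 2 ^ k"
        by (simp add: a_def b_def add_divide_distrib)
      also have "real (2 ^ k) * (2 * ((\<bar>s\<bar> + \<bar>t\<bar>) / 2 ^ k)\<^sup>2 * hnorm H (g (g x))) = C * (1 / 2) ^ k"
        by (simp add: C_def power_divide power2_eq_square)
      finally have close: "hnorm H (P (s + t) k x - P s k (P t k x)) \<le> C * (1 / 2) ^ k"
        unfolding 1 2 .
      have "hnorm H (P (s + t) k x - W s (W t x)) \<le>
        hnorm H (P (s + t) k x - P s k (P t k x)) + hnorm H (P s k (P t k x) - W s (W t x))"
        using xc c W_lim(1) by (intro hnorm_dist_triangle) auto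
      \<comment> \<open>Both factors vary with \<open>k\<close>; contractivity of
        \<open>P s k\<close> lets the inner limit be taken first.\<close>
      also have "hnorm H (P s k (P t k x) - W s (W t x)) \<le>
        hnorm H (P s k (P t k x) - P s k (W t x)) + hnorm H (P s k (W t x) - W s (W t x))"
        using xc c W_lim(1) by (intro hnorm_dist_triangle) auto
      also have "hnorm H (P s k (P t k x) - P s k (W t x)) \<le> hnorm H (P t k x - W t x)"
        using xc c W_lim(1) by (intro P_simps(4)) auto
      finally have "hnorm H (P (s + t) k x - W s (W t x)) \<le>
          hnorm H (P (s + t) k x - P s k (P t k x)) +
          (hnorm H (P t k x - W t x) + hnorm H (P s k (W t x) - W s (W t x)))" by simp
      with close show ?thesis by linarith
    qed
    then show "\<forall>\<^sub>F k in sequentially. norm (hnorm H (P (s + t) k x - W s (W t x))) \<le>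
      C * (1 / 2) ^ k + (hnorm H (P t k x - W t x) + hnorm H (P s k (W t x) - W s (W t x)))"
      using xc c W_lim(1) by (simp add: hnorm_nonneg)
    have 1: "(\<lambda>k. C * (1 / 2) ^ k) \<longlonglongrightarrow> 0"
      by (intro tendsto_mult_right_zero LIMSEQ_power_zero) simp
    have 2: "(\<lambda>k. hnorm H (P t k x - W t x)) \<longlonglongrightarrow> 0"
      using W_lim(2)[OF xc, of t] by (simp add: hconverges_def)
    have 3: "(\<lambda>k. hnorm H (P s k (W t x) - W s (W t x))) \<longlonglongrightarrow> 0"
      using W_lim(2)[OF W_lim(1)[OF xc], of s t] by (simp add: hconverges_def)
    show "(\<lambda>k. C * (1 / 2) ^ k + (hnorm H (P t k x - W t x) + hnorm H (P s k (W t x) - W s (W t x)))) \<longlonglongrightarrow> 0"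
      using tendsto_add[OF 1 tendsto_add[OF 2 3]] by simp
  qed
  then show "W (s + t) x = W s (W t x)"
    using xc c W_lim by (intro hconverges_unique[of "\<lambda>k. P (s + t) k x"]) auto
qed

lemma W_inverse: "x \<in> carrier H \<Longrightarrow> W (- t) (W t x) = x" "x \<in> carrier H \<Longrightarrow> W t (W (- t) x) = x"
  using W_add[of x "- t" t] W_add[of x t "- t"] by (simp_all add: W_0)

lemma W_isometric:
  "x \<in> carrier H \<Longrightarrow> y \<in> carrier H \<Longrightarrow> ip H (W t x) (W t y) = ip H x y"
  by (simp add: W_adjoint W_simps W_inverse)

lemma W_tendsto_0:
  assumes x: "x \<in> carrier H"
  shows "((\<lambda>t. hnorm H (W t x - x)) \<longlongrightarrow> 0) (at 0)"
proof (rule LIM_I)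
  fix e :: real assume "e > 0"
  then have "e / 4 > 0" by simp
  then obtain z where z: "z \<in> D" "hnorm H (x - z) < e / 4"
    using dense_D x unfolding dense_in_def by blast
  have zc: "z \<in> carrier H" using z D_carrier by auto
  have pos: "hnorm H (g z) \<ge> 0" using z by (simp add: hnorm_nonneg g_carrier)
  define d where "d = e / (4 * (hnorm H (g z) + 1))"
  have d: "d > 0" using \<open>e > 0\<close> pos by (simp add: d_def)
  have "hnorm H (W t x - x) < e" if t: "\<bar>t\<bar> < d" for t
  proof -
    have "\<bar>t\<bar> * hnorm H (g z) \<le> d * (hnorm H (g z) + 1)"
      using t pos by (intro mult_mono) auto
    also have "\<dots> = e / 4"
    proof -
      have "e / (4 * q) * q = e / 4" if "q \<noteq> 0" for q :: real using that by simp
      from this[of "hnorm H (g z) + 1"] pos show ?thesis unfolding d_def by linarith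
    qed
    finally have 1: "hnorm H (W t z - z) \<le> e / 4" using W_diff_id_le[OF z(1), of t] by simp
    have "hnorm H (W t x - x) \<le> hnorm H (W t x - W t z) + hnorm H (W t z - x)"
      using x zc by (intro hnorm_dist_triangle) (auto simp: W_simps)
    also have "hnorm H (W t z - x) \<le> hnorm H (W t z - z) + hnorm H (z - x)"
      using x zc by (intro hnorm_dist_triangle) (auto simp: W_simps)
    finally show ?thesis
      using 1 z(2) W_simps(4)[OF x zc, of t] hnorm_minus_commute[OF x zc] \<open>e > 0\<close> by simp
  qed
  then show "\<exists>d>0. \<forall>t. t \<noteq> 0 \<and> norm (t - 0) < d \<longrightarrow> norm (hnorm H (W t x - x) - 0) < e"
    using d x by (intro exI[of _ d]) (auto simp: hnorm_nonneg W_simps)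
qed

text \<open>The group law and contractivity of \<open>W t\<^sub>0\<close> move the question to time
  \<open>0\<close>.\<close>

lemma W_continuous:
  assumes x: "x \<in> carrier H"
  shows "((\<lambda>t. hnorm H (W t x - W t\<^sub>0 x)) \<longlongrightarrow> 0) (at t\<^sub>0)"
proof -
  have "hnorm H (W (t\<^sub>0 + h) x - W t\<^sub>0 x) \<le> hnorm H (W h x - x)" for h
    using x W_simps(4)[of "W h x" x t\<^sub>0] by (simp add: W_add W_simps)
  then have "((\<lambda>h. hnorm H (W (t\<^sub>0 + h) x - W t\<^sub>0 x)) \<longlongrightarrow> 0) (at 0)"
    using x by (intro Lim_null_comparison[OF _ W_tendsto_0[OF x]]) (auto simp: hnorm_nonneg W_simps)
  then show ?thesis
    by (rule LIM_offset_zero_cancel)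
qed

text \<open>\<open>x\<close> is split into \<open>z \<in> D2\<close> and a remainder. On
  \<open>z\<close>, the group is compared with one Euler step, whose expansion is explicit to second
  order; on the remainder, the difference quotient and \<open>g\<close> are both bounded by the norm
  of \<open>g (x - z)\<close>.\<close>

lemma W_derivative:
  assumes x: "x \<in> D"
  shows "((\<lambda>t. hnorm H (complex_of_real (1 / t) *\<^sub>C (W t x - x) - g x)) \<longlongrightarrow> 0) (at 0)"
proof (rule LIM_I)
  fix e :: real assume "e > 0"
  then have "e / 4 > 0" by simp
  then obtain z where z: "z \<in> D2" "hnorm H (g (x - z)) < e / 4"
    using D2_core[OF x] by blast
  note zD = D2_D[OF z(1)]
  define w where "w = hnorm H (g (g z))"
  have w: "w \<ge> 0" using zD by (simp add: w_def hnorm_nonneg g_carrier)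
  \<comment> \<open>The second-order errors \<open>4 * t\<^sup>2 * w\<close> and
    \<open>t\<^sup>2 * w\<close> add to \<open>5 * t\<^sup>2 * w\<close>; after division by
    \<open>\<bar>t\<bar>\<close> they use up at most \<open>e / 2\<close>, and the remainder term
    takes less than the other half.\<close>
  define d where "d = e / (10 * (w + 1))"
  have d: "d > 0" using \<open>e > 0\<close> w by (simp add: d_def)
  have xz: "x - z \<in> D" using x zD by (simp add: D_diff)
  have c: "x \<in> carrier H" "z \<in> carrier H" "g x \<in> carrier H" "g z \<in> carrier H" "g (g z) \<in> carrier H"
    "g (x - z) \<in> carrier H"
    using x zD xz by (simp_all add: D_carrier g_carrier)
  have "hnorm H (complex_of_real (1 / t) *\<^sub>C (W t x - x) - g x) < e" if t: "\<bar>t\<bar> < d" "t \<noteq> 0" for t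
  proof -
    let ?t = "complex_of_real t"
    have "W t x - x - ?t *\<^sub>C g x =
        ((W t (x - z) - (x - z)) - ?t *\<^sub>C g (x - z)) + ((W t z - E t z) + (E t z - z - ?t *\<^sub>C g z))"
      using c x zD by (simp add: W_simps g_diff complex_vector.scale_right_diff_distrib)
    also have "hnorm H \<dots> \<le> (hnorm H (W t (x - z) - (x - z)) + hnorm H (?t *\<^sub>C g (x - z))) +
        (hnorm H (W t z - E t z) + hnorm H (E t z - z - ?t *\<^sub>C g z))"
      by (rule order_trans[OF hnorm_triangle add_mono[OF hnorm_triangle_diff hnorm_triangle]])
        (use c in \<open>auto simp: W_simps E_simps\<close>)
    also have "hnorm H (?t *\<^sub>C g (x - z)) = \<bar>t\<bar> * hnorm H (g (x - z))"
      using c by (simp add: hnorm_scale)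
    also have "hnorm H (W t (x - z) - (x - z)) \<le> \<bar>t\<bar> * hnorm H (g (x - z))"
      using W_diff_id_le[OF xz] .
    also have "hnorm H (W t z - E t z) \<le> 4 * t\<^sup>2 * w"
      using W_diff_E_le[OF z(1)] by (simp add: w_def)
    also have "E t z - z - ?t *\<^sub>C g z = complex_of_real (t\<^sup>2) *\<^sub>C E t (g (g z))"
      using E_expand2[OF z(1), of t] by (simp add: algebra_simps)
    also have "hnorm H \<dots> \<le> t\<^sup>2 * w"
      using c E_simps(2)[of "g (g z)" t]
      by (simp add: hnorm_scale E_simps w_def norm_power mult_left_mono del: of_real_power)
    finally have "hnorm H (W t x - x - ?t *\<^sub>C g x) \<le> 2 * \<bar>t\<bar> * hnorm H (g (x - z)) + 5 * t\<^sup>2 * w"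
      by (simp add: algebra_simps)
    also have "\<dots> = \<bar>t\<bar> * (2 * hnorm H (g (x - z)) + 5 * (\<bar>t\<bar> * w))"
      by (simp add: algebra_simps power2_eq_square)
    also have "\<dots> < \<bar>t\<bar> * e"
    proof (rule mult_strict_left_mono)
      have "\<bar>t\<bar> * w \<le> d * (w + 1)" using t w by (intro mult_mono) auto
      also have "\<dots> = e / 10"
      proof -
        have "e / (10 * q) * q = e / 10" if "q \<noteq> 0" for q :: real using that by simp
        from this[of "w + 1"] w show ?thesis unfolding d_def by linarith
      qed
      finally show "2 * hnorm H (g (x - z)) + 5 * (\<bar>t\<bar> * w) < e" using z(2) by simp
    qed (use t in simp)
    finally have less: "hnorm H (W t x - x - ?t *\<^sub>C g x) < \<bar>t\<bar> * e" .
    have "complex_of_real (1 / t) *\<^sub>C (W t x - x) - g x = complex_of_real (1 / t) *\<^sub>C (W t x - x - ?t *\<^sub>C g x)"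
      using t(2) by (simp add: complex_vector.scale_right_diff_distrib scaleC_scaleC scaleC_one)
    then have "hnorm H (complex_of_real (1 / t) *\<^sub>C (W t x - x) - g x) =
        hnorm H (W t x - x - ?t *\<^sub>C g x) / \<bar>t\<bar>"
      using c by (simp add: hnorm_scale W_simps norm_divide)
    also have "\<dots> < e" using less t(2) by (simp add: pos_divide_less_eq mult.commute)
    finally show ?thesis .
  qed
  then show "\<exists>d>0. \<forall>t. t \<noteq> 0 \<and> norm (t - 0) < d \<longrightarrow>
      norm (hnorm H (complex_of_real (1 / t) *\<^sub>C (W t x - x) - g x) - 0) < e"
    using d c by (intro exI[of _ d]) (auto simp: hnorm_nonneg W_simps)
qed

text \<open>The generator is not larger than \<open>g\<close>: it is skew with respect to
  \<open>g\<close>, so \<open>maximal\<close> puts its domain inside \<open>D\<close>.\<close>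

lemma W_derivative_imp_D:
  assumes x: "x \<in> carrier H" "y \<in> carrier H"
    and lim: "((\<lambda>t. hnorm H (complex_of_real (1 / t) *\<^sub>C (W t x - x) - y)) \<longlongrightarrow> 0) (at 0)"
  shows "x \<in> D \<and> g x = y"
proof (rule maximal[OF x])
  fix f assume f: "f \<in> D"
  have fc: "f \<in> carrier H" "g f \<in> carrier H" using f by (simp_all add: D_carrier g_carrier)
  define q where "q t u = complex_of_real (1 / t) *\<^sub>C (W t u - u)" for t u
  \<comment> \<open>Continuity of the inner product is available along sequences. Both signs occur
    because the adjoint of the difference quotient at \<open>t\<close> is the negative of the one at
    \<open>- t\<close>.\<close>
  define \<tau> where "\<tau> n = inverse (real (Suc n))" for n
  have \<tau>: "filterlim \<tau> (at 0) sequentially"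
    unfolding filterlim_at \<tau>_def using LIMSEQ_inverse_real_of_nat by (auto intro: always_eventually)
  have \<tau>': "filterlim (\<lambda>n. - \<tau> n) (at 0) sequentially"
    using tendsto_minus[OF LIMSEQ_inverse_real_of_nat]
    unfolding filterlim_at \<tau>_def by (auto intro: always_eventually)
  have qc: "q t u \<in> carrier H" if "u \<in> carrier H" for t u using that by (simp add: q_def W_simps)
  have "hconverges H (\<lambda>n. q (\<tau> n) f) (g f)"
    unfolding hconverges_def q_def using W_derivative[OF f] \<tau> by (rule filterlim_compose)
  then have 1: "(\<lambda>n. ip H (q (\<tau> n) f) x) \<longlonglongrightarrow> ip H (g f) x"
    using fc x qc by (intro hconverges_ip_left) auto
  have "hconverges H (\<lambda>n. q (- \<tau> n) x) y"
    unfolding hconverges_def q_def using lim \<tau>' by (rule filterlim_compose)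
  then have 2: "(\<lambda>n. - ip H f (q (- \<tau> n) x)) \<longlonglongrightarrow> - ip H f y"
    using fc x qc by (intro tendsto_minus hconverges_ip_right) auto
  have "ip H (q t f) x = - ip H f (q (- t) x)" for t
    using fc x by (simp add: q_def ip_simps W_simps W_adjoint)
  then show "ip H (g f) x = - ip H f y"
    using 1 2 by (simp add: LIMSEQ_unique)
qed

theorem generates_unitary_group: "generates_unitary_group H (\<lambda>x. if x \<in> D then Some (g x) else None)"
  unfolding generates_unitary_group_def
proof (intro exI conjI)
  define U where "U t x = (if x \<in> carrier H then Some (W t x) else None)" for t x
  have dom_U: "dom (U t) = carrier H" for t by (auto simp: U_def split: if_splits)
  have ran_U: "ran (U t) = carrier H" for t
  proof
    show "ran (U t) \<subseteq> carrier H" by (auto simp: U_def ran_def W_simps split: if_splits)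
    show "carrier H \<subseteq> ran (U t)"
    proof
      fix x assume "x \<in> carrier H"
      then have "U t (W (- t) x) = Some x" by (simp add: U_def W_simps W_inverse)
      then show "x \<in> ran (U t)" by (auto simp: ran_def)
    qed
  qed
  have the_U: "the (U t x) = W t x" if "x \<in> carrier H" for t x using that by (simp add: U_def)
  have hilb: "hilbert_space H" unfolding hilbert_iff by unfold_locales
  show "unitary_group H U" unfolding unitary_group_def
  proof (intro conjI allI ballI)
    fix t
    show "unitary H H (U t)" unfolding unitary_def linear_op_def dom_U ran_U
      using hilb subspace_carrier by (auto simp: the_U W_linear W_isometric)
    show "U 0 = id_op (carrier H)"
      by (auto simp: U_def id_op_def restrict_map_def W_0)
    show "U (s + t) = U s \<circ>\<^sub>m U t" for s
      by (auto simp: U_def map_comp_def W_add W_simps)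
    show "((\<lambda>s. hnorm H (the (U s x) - the (U t x))) \<longlongrightarrow> 0) (at t)" if "x \<in> carrier H" for x
      using W_continuous[OF that] that by (simp add: the_U)
  qed
  show "generator H U = (\<lambda>x. if x \<in> D then Some (g x) else None)"
    unfolding generator_def
  proof (rule op_graph_eqI)
    fix x y
    show "(x \<in> carrier H \<and> y \<in> carrier H \<and>
        ((\<lambda>t. hnorm H (complex_of_real (1 / t) *\<^sub>C (the (U t x) - x) - y)) \<longlongrightarrow> 0) (at 0)) \<longleftrightarrow>
        (if x \<in> D then Some (g x) else None) = Some y"
      using W_derivative[of x] W_derivative_imp_D[of x y]
      by (auto simp: the_U D_carrier g_carrier split: if_splits)
  qed
qed

end

subsection \<open>Stone's theorem and direct sums\<close>

lemma op_graph_iff: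
  assumes unique: "\<And>y z. R x y \<Longrightarrow> R x z \<Longrightarrow> y = z"
  shows "op_graph R x = Some y \<longleftrightarrow> R x y"
proof
  assume "op_graph R x = Some y"
  then have ex: "\<exists>!y. R x y" and y: "y = (THE y. R x y)"
    unfolding op_graph_def by (simp_all split: if_splits)
  show "R x y" unfolding y using ex by (rule theI')
next
  assume R: "R x y"
  then have ex: "\<exists>!y. R x y" using unique by blast
  then show "op_graph R x = Some y"
    using R by (simp add: op_graph_def the1_equality[OF ex])
qed

lemma map_eqI: "(\<And>x y. f x = Some y \<longleftrightarrow> g x = Some y) \<Longrightarrow> f = g"
  by (rule ext) (metis option.exhaust)

lemma zero_op_eq_Some [simp]: "zero_op S x = Some y \<longleftrightarrow> x \<in> S \<and> y = 0"
  by (auto simp: zero_op_def restrict_map_def)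

lemma id_op_eq_Some [simp]: "id_op S x = Some y \<longleftrightarrow> x \<in> S \<and> y = x"
  by (auto simp: id_op_def restrict_map_def)

lemma scale_op_eq_Some: "(c *\<^sub>O T) x = Some y \<longleftrightarrow> (\<exists>z. T x = Some z \<and> y = c *\<^sub>C z)"
  by (auto simp: scale_op_def)

lemma dom_scale_op: "dom (c *\<^sub>O T) = dom T"
  by (auto simp: scale_op_def dom_def)

lemma block_op_eq_Some:
  "block_op T11 T12 T21 T22 (f, g) = Some (p, q) \<longleftrightarrow>
    (\<exists>p1 p2 q1 q2. T11 f = Some p1 \<and> T12 g = Some p2 \<and> T21 f = Some q1 \<and> T22 g = Some q2 \<and>
      p = p1 + p2 \<and> q = q1 + q2)"
  by (auto simp: block_op_def dom_def)

lemma scaleC_prod_simp [simp]: "c *\<^sub>C (x, y) = (c *\<^sub>C x, c *\<^sub>C y)"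
  by (simp add: scaleC_prod_def)

lemma linear_opI:
  assumes "hilbert_space H" "hilbert_space K"
    and carrier: "\<And>x y. T x = Some y \<Longrightarrow> x \<in> carrier H \<and> y \<in> carrier K"
    and zero: "T 0 = Some 0"
    and add: "\<And>x y x' y'. T x = Some y \<Longrightarrow> T x' = Some y' \<Longrightarrow> T (x + x') = Some (y + y')"
    and scale: "\<And>x y c. T x = Some y \<Longrightarrow> T (c *\<^sub>C x) = Some (c *\<^sub>C y)"
  shows "linear_op H K T"
  unfolding linear_op_def complex_vector.subspace_def
proof (intro conjI)
  show "ran T \<subseteq> carrier K" using carrier by (auto simp: ran_def)
qed (use assms in \<open>auto simp: dom_def\<close>)

text \<open>Two candidates for the value of the adjoint differ by a vector orthogonal to the dense
  domain, so the defining relation is single-valued and \<open>op_graph\<close> loses no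
  pair.\<close>

lemma adj_op_iff:
  assumes "linear_op H K T" "densely_defined H T"
  shows "adj_op H K T g = Some h \<longleftrightarrow>
    g \<in> carrier K \<and> h \<in> carrier H \<and> (\<forall>f\<in>dom T. ip K (the (T f)) g = ip H f h)"
  unfolding adj_op_def
proof (rule op_graph_iff)
  interpret hilbert H using linear_opD(1)[OF assms(1)] by (simp add: hilbert_iff)
  fix y z
  assume y: "g \<in> carrier K \<and> y \<in> carrier H \<and> (\<forall>f\<in>dom T. ip K (the (T f)) g = ip H f y)"
    and z: "g \<in> carrier K \<and> z \<in> carrier H \<and> (\<forall>f\<in>dom T. ip K (the (T f)) g = ip H f z)"
  have "y - z = 0"
    using assms(2) unfolding densely_defined_def
  proof (rule eq_zero_if_orth_dense)
    fix f assume f: "f \<in> dom T"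
    then have "f \<in> carrier H" using linear_opD(4)[OF assms(1)] by blast
    then show "ip H f (y - z) = 0" using y z f by (simp add: ip_diff_right)
  qed (use y z in simp)
  then show "y = z" by simp
qed

text \<open>With \<open>T = \<i> G\<close>, the inclusion of \<open>T\<close> in its adjoint is
  skewness of \<open>G\<close>, and the reverse inclusion is \<open>maximal\<close>.\<close>

theorem selfadjoint_generates_unitary_group:
  assumes "selfadjoint H (\<i> *\<^sub>O G)"
  shows "generates_unitary_group H G"
proof -
  define T where "T = \<i> *\<^sub>O G"
  have T: "linear_op H H T" "densely_defined H T" "adj_op H H T = T"
    using assms by (simp_all add: selfadjoint_def T_def)
  interpret hilbert H using linear_opD(1)[OF T(1)] by (simp add: hilbert_iff)
  note lin = linear_opD[OF T(1)]
  note adj = adj_op_iff[OF T(1,2), unfolded T(3)]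
  have dom_T: "dom T = dom G" by (simp add: T_def dom_scale_op)
  have the_T: "the (T x) = \<i> *\<^sub>C the (G x)" if "x \<in> dom G" for x
    using that by (auto simp: T_def scale_op_def)
  have the_G: "the (G x) = (- \<i>) *\<^sub>C the (T x)" if "x \<in> dom G" for x
    using that by (simp add: the_T scaleC_scaleC scaleC_one)
  interpret skew_adjoint H "dom G" "\<lambda>x. the (G x)"
  proof
    show "complex_vector.subspace (dom G)" using lin(3) by (simp add: dom_T)
    show "dense_in H (dom G)" using T(2) by (simp add: densely_defined_def dom_T)
    fix x assume x: "x \<in> dom G"
    show Gx: "the (G x) \<in> carrier H" unfolding the_G[OF x] using lin(8)[of x] x by (simp add: dom_T)
    show "the (G (c *\<^sub>C x)) = c *\<^sub>C the (G x)" for c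
    proof -
      have "c *\<^sub>C x \<in> dom G"
        using lin(3) x by (simp add: dom_T complex_vector.subspace_scale)
      then show ?thesis using lin(7)[of x c] x by (simp add: the_G dom_T scaleC_scaleC mult.commute)
    qed
    fix y assume y: "y \<in> dom G"
    show "the (G (x + y)) = the (G x) + the (G y)"
    proof -
      have "x + y \<in> dom G"
        using lin(3) x y by (simp add: dom_T complex_vector.subspace_add)
      then show ?thesis using lin(6)[of x y] x y
        by (simp add: the_G dom_T complex_vector.scale_right_distrib)
    qed
    have c: "x \<in> carrier H" "y \<in> carrier H" "the (T x) \<in> carrier H" "the (T y) \<in> carrier H"
      using x y lin(4) lin(8) dom_T by auto
    have "T y = Some (the (T y))" using y dom_T by (metis domD option.sel)
    then have "ip H (the (T x)) y = ip H x (the (T y))"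
      using adj[of y "the (T y)"] x dom_T by blast
    then show "ip H (the (G x)) y = - ip H x (the (G y))"
      using c by (simp add: the_G x y ip_simps)
  next
    fix y z assume yz: "y \<in> carrier H" "z \<in> carrier H"
      and *: "\<And>x. x \<in> dom G \<Longrightarrow> ip H (the (G x)) y = - ip H x z"
    \<comment> \<open>Antilinearity in the first argument turns \<open>\<i>\<close> into
      \<open>- \<i>\<close>, which meets the minus sign of the hypothesis; hence the value
      \<open>\<i> *\<^sub>C z\<close>.\<close>
    have "ip H (the (T x)) y = ip H x (\<i> *\<^sub>C z)" if x: "x \<in> dom G" for x
    proof -
      have c: "x \<in> carrier H" "the (T x) \<in> carrier H" using x lin(4) lin(8) dom_T by auto
      then have "the (G x) \<in> carrier H" by (simp add: the_G x)
      then show ?thesis using *[OF x] c yz by (simp add: the_T[OF x] ip_simps)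
    qed
    then have "T y = Some (\<i> *\<^sub>C z)" using adj[of y "\<i> *\<^sub>C z"] yz dom_T by simp
    then obtain v where v: "G y = Some v" "\<i> *\<^sub>C z = \<i> *\<^sub>C v"
      unfolding T_def scale_op_eq_Some by blast
    then show "y \<in> dom G \<and> the (G y) = z" by (auto simp: dom_def)
  qed
  have "(\<lambda>x. if x \<in> dom G then Some (the (G x)) else None) = G"
    by (auto simp: dom_def fun_eq_iff)
  then show ?thesis using generates_unitary_group by simp
qed

section \<open>Direct sums of Hilbert spaces\<close>

lemma carrier_direct_sum [simp]: "carrier (H \<oplus>\<^sub>H K) = carrier H \<times> carrier K"
  by (simp add: direct_sum_def)

lemma ip_direct_sum [simp]: "ip (H \<oplus>\<^sub>H K) p q = ip H (fst p) (fst q) + ip K (snd p) (snd q)"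
  by (simp add: direct_sum_def)

lemma hnorm_direct_sum:
  assumes "ips H" "ips K" "x \<in> carrier H" "y \<in> carrier K"
  shows "hnorm (H \<oplus>\<^sub>H K) (x, y) = sqrt ((hnorm H x)\<^sup>2 + (hnorm K y)\<^sup>2)"
  using ips.hnorm_power2[OF assms(1,3)] ips.hnorm_power2[OF assms(2,4)]
  by (simp add: hnorm_def[of "H \<oplus>\<^sub>H K"])

lemma hnorm_direct_sum_le:
  assumes "ips H" "ips K" "x \<in> carrier H" "y \<in> carrier K"
  shows "hnorm H x \<le> hnorm (H \<oplus>\<^sub>H K) (x, y)" "hnorm K y \<le> hnorm (H \<oplus>\<^sub>H K) (x, y)"
    "hnorm (H \<oplus>\<^sub>H K) (x, y) \<le> hnorm H x + hnorm K y"
  using ips.hnorm_nonneg[OF assms(1,3)] ips.hnorm_nonneg[OF assms(2,4)]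
  by (auto simp: hnorm_direct_sum[OF assms] intro: real_le_rsqrt sqrt_sum_squares_le_sum)

lemma ips_direct_sum:
  assumes "ips H" "ips K"
  shows "ips (H \<oplus>\<^sub>H K)"
proof
  interpret H: ips H by fact
  interpret K: ips K by fact
  have pos: "0 < Re (ip H x x) + Re (ip K y y)"
    if "x \<in> carrier H" "y \<in> carrier K" "x \<noteq> 0 \<or> y \<noteq> 0" for x y
    using that H.ip_pos[of x] K.ip_pos[of y] H.Re_ip_self_nonneg[of x] K.Re_ip_self_nonneg[of y]
    by force
  have cnj: "ip H x' x + ip K y' y = cnj (ip H x x') + cnj (ip K y y')"
    if "x \<in> carrier H" "y \<in> carrier K" "x' \<in> carrier H" "y' \<in> carrier K" for x y x' y'
    using that H.ip_cnj[of x x'] K.ip_cnj[of y y'] by simp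
  show "inner_product_space (H \<oplus>\<^sub>H K)"
    unfolding inner_product_space_def complex_vector.subspace_def
  proof (intro conjI ballI allI impI)
    fix x y assume "x \<in> carrier (H \<oplus>\<^sub>H K)" "y \<in> carrier (H \<oplus>\<^sub>H K)"
    then show "ip (H \<oplus>\<^sub>H K) y x = cnj (ip (H \<oplus>\<^sub>H K) x y)"
      using cnj[of "fst x" "snd x" "fst y" "snd y"] by (auto simp: mem_Times_iff)
  next
    fix x assume "x \<in> carrier (H \<oplus>\<^sub>H K)" "x \<noteq> 0"
    then show "0 < Re (ip (H \<oplus>\<^sub>H K) x x)"
      using pos[of "fst x" "snd x"] by (auto simp: prod_eq_iff)
  qed (auto simp: zero_prod_def scaleC_prod_def H.ip_simps K.ip_simps algebra_simps)
qed

lemma hconverges_direct_sum: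
  assumes "ips H" "ips K" "range s \<subseteq> carrier (H \<oplus>\<^sub>H K)" "p \<in> carrier (H \<oplus>\<^sub>H K)"
  shows "hconverges (H \<oplus>\<^sub>H K) s p \<longleftrightarrow>
    hconverges H (\<lambda>n. fst (s n)) (fst p) \<and> hconverges K (\<lambda>n. snd (s n)) (snd p)"
proof -
  interpret H: ips H by fact
  interpret K: ips K by fact
  have sc: "fst (s n) \<in> carrier H" "snd (s n) \<in> carrier K" for n
    using subsetD[OF assms(3) rangeI[of s n]] by (simp_all add: mem_Times_iff)
  have pc: "fst p \<in> carrier H" "snd p \<in> carrier K" using assms(4) by auto
  have eq: "s n - p = (fst (s n) - fst p, snd (s n) - snd p)" for n by (simp add: prod_eq_iff)
  note le = hnorm_direct_sum_le[OF assms(1,2), of "fst (s n) - fst p" "snd (s n) - snd p" for n]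
  have nn: "0 \<le> hnorm H (fst (s n) - fst p)" "0 \<le> hnorm K (snd (s n) - snd p)" for n
    using sc pc by (simp_all add: H.hnorm_nonneg K.hnorm_nonneg)
  show ?thesis
    unfolding hconverges_def eq
  proof (intro iffI conjI; (elim conjE)?)
    assume *: "(\<lambda>n. hnorm (H \<oplus>\<^sub>H K) (fst (s n) - fst p, snd (s n) - snd p)) \<longlonglongrightarrow> 0"
    show "(\<lambda>n. hnorm H (fst (s n) - fst p)) \<longlonglongrightarrow> 0"
      by (rule Lim_null_comparison[OF _ *]) (use le sc pc nn in simp)
    show "(\<lambda>n. hnorm K (snd (s n) - snd p)) \<longlonglongrightarrow> 0"
      by (rule Lim_null_comparison[OF _ *]) (use le sc pc nn in simp)
  next
    assume *: "(\<lambda>n. hnorm H (fst (s n) - fst p)) \<longlonglongrightarrow> 0" "(\<lambda>n. hnorm K (snd (s n) - snd p)) \<longlonglongrightarrow> 0"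
    have sum_ge: "norm (hnorm (H \<oplus>\<^sub>H K) (fst (s n) - fst p, snd (s n) - snd p)) \<le>
        hnorm H (fst (s n) - fst p) + hnorm K (snd (s n) - snd p)" for n
      using le[of n] nn[of n] sc pc by simp
    have "(\<lambda>n. hnorm H (fst (s n) - fst p) + hnorm K (snd (s n) - snd p)) \<longlonglongrightarrow> 0"
      using tendsto_add[OF *] by simp
    then show "(\<lambda>n. hnorm (H \<oplus>\<^sub>H K) (fst (s n) - fst p, snd (s n) - snd p)) \<longlonglongrightarrow> 0"
      by (rule Lim_null_comparison[OF always_eventually[OF allI[OF sum_ge]]])
  qed
qed

lemma hilbert_direct_sum:
  assumes "hilbert H" "hilbert K"
  shows "hilbert (H \<oplus>\<^sub>H K)"
proof -
  interpret H: hilbert H by fact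
  interpret K: hilbert K by fact
  note i = H.ips_axioms K.ips_axioms
  interpret HK: ips "H \<oplus>\<^sub>H K" by (rule ips_direct_sum[OF i])
  show ?thesis
  proof
    fix s assume s: "range s \<subseteq> carrier (H \<oplus>\<^sub>H K)" and C: "hCauchy (H \<oplus>\<^sub>H K) s"
    have sc: "fst (s n) \<in> carrier H" "snd (s n) \<in> carrier K" for n
      using subsetD[OF s rangeI[of s n]] by (simp_all add: mem_Times_iff)
    have le: "hnorm H (fst (s m) - fst (s n)) \<le> hnorm (H \<oplus>\<^sub>H K) (s m - s n)"
      "hnorm K (snd (s m) - snd (s n)) \<le> hnorm (H \<oplus>\<^sub>H K) (s m - s n)" for m n
      using hnorm_direct_sum_le[OF i, of "fst (s m) - fst (s n)" "snd (s m) - snd (s n)"] sc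
      by (simp_all add: minus_prod_def)
    have "hCauchy H (\<lambda>n. fst (s n))" "hCauchy K (\<lambda>n. snd (s n))"
      using C unfolding hCauchy_def by (meson le le_less_trans)+
    then obtain x y where "x \<in> carrier H" "hconverges H (\<lambda>n. fst (s n)) x"
        "y \<in> carrier K" "hconverges K (\<lambda>n. snd (s n)) y"
      using H.complete[of "\<lambda>n. fst (s n)"] K.complete[of "\<lambda>n. snd (s n)"] sc by blast
    then show "\<exists>x\<in>carrier (H \<oplus>\<^sub>H K). hconverges (H \<oplus>\<^sub>H K) s x"
      using hconverges_direct_sum[OF i s, of "(x, y)"] by (intro bexI[of _ "(x, y)"]) auto
  qed
qed

subsection \<open>The operators associated with a closed operator bounded below\<close>

declare domIff [iff del]

locale closed_dense_op =
  fixes H1 :: "'a::complex_vector hspace" and H2 :: "'b::complex_vector hspace" and A :: "'a \<rightharpoonup> 'b"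
  assumes linear: "linear_op H1 H2 A" and dense: "densely_defined H1 A" and closed: "closed_op H1 H2 A"

sublocale closed_dense_op \<subseteq> H1: hilbert H1
  using linear_opD(1)[OF linear] by (simp add: hilbert_iff)

sublocale closed_dense_op \<subseteq> H2: hilbert H2
  using linear_opD(2)[OF linear] by (simp add: hilbert_iff)

context closed_dense_op
begin

abbreviation a :: "'a \<Rightarrow> 'b" where "a f \<equiv> the (A f)"

abbreviation A' :: "'b \<rightharpoonup> 'a" where "A' \<equiv> adj_op H1 H2 A"

lemma A_eq_Some: "A f = Some g \<longleftrightarrow> f \<in> dom A \<and> g = a f"
  by (auto simp: dom_def)

lemma dom_carrier: "f \<in> dom A \<Longrightarrow> f \<in> carrier H1"
  using linear_opD(4)[OF linear] by blast

lemma a_carrier: "f \<in> dom A \<Longrightarrow> a f \<in> carrier H2"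
  by (rule linear_opD(8)[OF linear])

lemma a_add: "f \<in> dom A \<Longrightarrow> f' \<in> dom A \<Longrightarrow> a (f + f') = a f + a f'"
  and a_scale: "f \<in> dom A \<Longrightarrow> a (c *\<^sub>C f) = c *\<^sub>C a f"
  using linear_opD(6,7)[OF linear] by auto

lemma dom_add: "f \<in> dom A \<Longrightarrow> f' \<in> dom A \<Longrightarrow> f + f' \<in> dom A"
  and dom_diff: "f \<in> dom A \<Longrightarrow> f' \<in> dom A \<Longrightarrow> f - f' \<in> dom A"
  and dom_scale: "f \<in> dom A \<Longrightarrow> c *\<^sub>C f \<in> dom A"
  and dom_zero: "0 \<in> dom A"
  using linear_opD(3)[OF linear]
  by (simp_all add: complex_vector.subspace_add complex_vector.subspace_diff
      complex_vector.subspace_scale complex_vector.subspace_0)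

lemma a_diff: "f \<in> dom A \<Longrightarrow> f' \<in> dom A \<Longrightarrow> a (f - f') = a f - a f'"
  using a_add[of f "(-1) *\<^sub>C f'"] a_scale[of f' "-1"] dom_scale[of f' "-1"] by simp

lemma a_zero [simp]: "a 0 = 0"
  using a_diff[OF dom_zero dom_zero] by simp

lemma A'_iff: "A' g = Some h \<longleftrightarrow>
    g \<in> carrier H2 \<and> h \<in> carrier H1 \<and> (\<forall>f\<in>dom A. ip H2 (a f) g = ip H1 f h)"
  by (rule adj_op_iff[OF linear dense])

lemma A'D:
  assumes "A' g = Some h"
  shows "g \<in> carrier H2" "h \<in> carrier H1" "f \<in> dom A \<Longrightarrow> ip H2 (a f) g = ip H1 f h"
    "f \<in> dom A \<Longrightarrow> ip H2 g (a f) = ip H1 h f"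
  using assms unfolding A'_iff
  by (auto, metis H1.ip_cnj H2.ip_cnj a_carrier dom_carrier)

lemma A'_zero: "A' 0 = Some 0"
  by (simp add: A'_iff a_carrier dom_carrier)

lemma A'_add: "A' g = Some h \<Longrightarrow> A' g' = Some h' \<Longrightarrow> A' (g + g') = Some (h + h')"
  by (simp add: A'_iff a_carrier dom_carrier H1.ip_simps H2.ip_simps)

lemma A'_scale: "A' g = Some h \<Longrightarrow> A' (c *\<^sub>C g) = Some (c *\<^sub>C h)"
  by (simp add: A'_iff a_carrier dom_carrier H1.ip_simps H2.ip_simps)

text \<open>von Neumann's argument: project \<open>(u, 0)\<close> orthogonally onto the graph of \<open>c A\<close>.\<close>

lemma resolvent_exists:
  assumes c: "c > 0" and u: "u \<in> carrier H1"
  shows "\<exists>f\<in>dom A. A' (a f) = Some (complex_of_real (1 / c\<^sup>2) *\<^sub>C (u - f))"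
proof -
  interpret HH: hilbert "H1 \<oplus>\<^sub>H H2"
    by (rule hilbert_direct_sum) unfold_locales
  have i: "ips H1" "ips H2" by unfold_locales
  let ?c = "complex_of_real c"
  define M where "M = (\<lambda>f. (f, ?c *\<^sub>C a f)) ` dom A"
  have M: "complex_vector.subspace M" "M \<subseteq> carrier (H1 \<oplus>\<^sub>H H2)"
    unfolding complex_vector.subspace_def M_def
    by (auto simp: image_iff zero_prod_def dom_zero dom_add dom_scale a_add a_scale a_carrier dom_carrier
        complex_vector.scale_right_distrib complex_vector.scale_left_commute)
  have "(u, 0) \<in> carrier (H1 \<oplus>\<^sub>H H2)" using u by simp
  from HH.projection[OF M this] obtain s y where s: "range s \<subseteq> M" and y: "y \<in> carrier (H1 \<oplus>\<^sub>H H2)"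
    "hconverges (H1 \<oplus>\<^sub>H H2) s y" and orth: "\<And>z. z \<in> M \<Longrightarrow> ip (H1 \<oplus>\<^sub>H H2) z ((u, 0) - y) = 0"
    by metis
  obtain p q where pq: "y = (p, q)" "p \<in> carrier H1" "q \<in> carrier H2" using y(1) by auto
  have "\<forall>n. \<exists>f\<in>dom A. s n = (f, ?c *\<^sub>C a f)" using s by (auto simp: M_def)
  then obtain f where f: "\<And>n. f n \<in> dom A" "\<And>n. s n = (f n, ?c *\<^sub>C a (f n))" by metis
  have lim: "hconverges H1 f p" "hconverges H2 (\<lambda>n. ?c *\<^sub>C a (f n)) q"
    using hconverges_direct_sum[OF i, of s y] s y M pq f(2) by auto
  have "hconverges H2 (\<lambda>n. (1 / ?c) *\<^sub>C ?c *\<^sub>C a (f n)) ((1 / ?c) *\<^sub>C q)"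
    using lim(2) pq f(1) by (intro H2.hconverges_scale) (auto simp: a_carrier)
  then have "hconverges H2 (\<lambda>n. a (f n)) ((1 / ?c) *\<^sub>C q)"
    using c by (simp add: scaleC_scaleC scaleC_one)
  \<comment> \<open>The projection lies only in the closure of the graph; closedness of
    \<open>A\<close> brings it back into the graph.\<close>
  then have "A p = Some ((1 / ?c) *\<^sub>C q)"
    using closed[unfolded closed_op_def, rule_format, of f p "(1 / ?c) *\<^sub>C q"] f(1) pq lim(1) by auto
  then have "p \<in> dom A" "a p = (1 / ?c) *\<^sub>C q" by (simp_all add: A_eq_Some)
  then have p: "p \<in> dom A" "q = ?c *\<^sub>C a p" using c by (simp_all add: scaleC_scaleC scaleC_one)
  have "A' (a p) = Some (complex_of_real (1 / c\<^sup>2) *\<^sub>C (u - p))"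
    unfolding A'_iff
  proof (intro conjI ballI)
    fix g assume g: "g \<in> dom A"
    \<comment> \<open>Orthogonality of the residual \<open>(u - p, - q)\<close> to the graph is
      exactly the adjoint relation for \<open>a p\<close>, up to the factor
      \<open>c\<^sup>2\<close>.\<close>
    have "ip H1 g (u - p) + ip H2 (?c *\<^sub>C a g) (0 - q) = 0"
      using orth[of "(g, ?c *\<^sub>C a g)"] imageI[OF g, of "\<lambda>f. (f, ?c *\<^sub>C a f)"]
      by (simp add: M_def pq(1))
    then have "ip H1 g (u - p) = ?c\<^sup>2 * ip H2 (a g) (a p)"
      using g p by (simp add: H2.ip_simps a_carrier power2_eq_square)
    then show "ip H2 (a g) (a p) = ip H1 g (complex_of_real (1 / c\<^sup>2) *\<^sub>C (u - p))"
      using c g u pq(2) by (simp add: H1.ip_scale_right dom_carrier)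
  qed (use p u pq in \<open>simp_all add: a_carrier\<close>)
  then show ?thesis using p(1) by blast
qed

end

section \<open>The lower bound on the whole domain and its consequences\<close>

locale bounded_below_op = closed_dense_op H1 H2 A
  for H1 :: "'a::complex_vector hspace" and H2 :: "'b::complex_vector hspace" and A :: "'a \<rightharpoonup> 'b" +
  fixes \<epsilon> :: real
  assumes eps: "\<epsilon> > 0" and ge: "op_ge H1 (adj_op H1 H2 A \<circ>\<^sub>m A) \<epsilon>"
begin

lemma bound_core:
  assumes "f \<in> dom A" "A' (a f) = Some h"
  shows "\<epsilon> * (hnorm H1 f)\<^sup>2 \<le> (hnorm H2 (a f))\<^sup>2"
proof -
  have "(A' \<circ>\<^sub>m A) f = Some h" using assms by (auto simp: map_comp_Some_iff A_eq_Some)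
  then have "\<epsilon> * (hnorm H1 f)\<^sup>2 \<le> Re (ip H1 f h)"
    using ge unfolding op_ge_def by (metis domI option.sel)
  then show ?thesis
    using A'D(3)[OF assms(2,1)] assms(1) by (simp add: H2.hnorm_power2 a_carrier)
qed

text \<open>
  The hypothesis only concerns \<open>dom (A\<^sup>* A)\<close>. With \<open>f\<^sub>c = (1 + c\<^sup>2 A\<^sup>* A)\<^sup>-\<^sup>1 f\<close> one has
  \<open>\<parallel>A f\<^sub>c\<parallel> \<le> \<parallel>A f\<parallel>\<close> and \<open>\<parallel>f - f\<^sub>c\<parallel> \<le> c \<parallel>A f\<parallel>\<close>, so the bound passes to all of \<open>dom A\<close> as \<open>c \<rightarrow> 0\<close>.
\<close>

lemma bound:
  assumes f: "f \<in> dom A"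
  shows "sqrt \<epsilon> * hnorm H1 f \<le> hnorm H2 (a f)"
proof -
  define N where "N = hnorm H2 (a f)"
  have N: "N \<ge> 0" using f by (simp add: N_def H2.hnorm_nonneg a_carrier)
  have "sqrt \<epsilon> * hnorm H1 f \<le> N + c * (sqrt \<epsilon> * N)" if c: "c > 0" for c
  proof -
    obtain g where g: "g \<in> dom A" "A' (a g) = Some (complex_of_real (1 / c\<^sup>2) *\<^sub>C (f - g))"
      using resolvent_exists[OF c dom_carrier[OF f]] by blast
    have fg: "f - g \<in> dom A" using f g by (simp add: dom_diff)
    note car = a_carrier[OF f] a_carrier[OF g(1)] dom_carrier[OF f] dom_carrier[OF g(1)]
    \<comment> \<open>Testing the resolvent equation with \<open>f - g\<close> produces one identity
      for \<open>Re (ip H2 (a f) (a g))\<close>, from which Cauchy-Schwarz gives both the bound on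
      \<open>a g\<close> and the bound on \<open>f - g\<close>.\<close>
    have "ip H2 (a (f - g)) (a g) = complex_of_real (1 / c\<^sup>2) * ip H1 (f - g) (f - g)"
      using A'D(3)[OF g(2) fg] car by (simp add: H1.ip_scale_right)
    then have "Re (ip H2 (a f - a g) (a g)) = Re (complex_of_real (1 / c\<^sup>2) * ip H1 (f - g) (f - g))"
      using f g by (simp add: a_diff)
    also have "\<dots> = (hnorm H1 (f - g))\<^sup>2 / c\<^sup>2"
      using car by (simp add: H1.hnorm_power2 flip: of_real_power)
    finally have eq: "Re (ip H2 (a f) (a g)) = (hnorm H2 (a g))\<^sup>2 + (hnorm H1 (f - g))\<^sup>2 / c\<^sup>2"
      using car by (simp add: H2.ip_simps H2.hnorm_power2)
    have CS: "Re (ip H2 (a f) (a g)) \<le> N * hnorm H2 (a g)"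
      using H2.Cauchy_Schwarz[OF car(1,2)] complex_Re_le_cmod[of "ip H2 (a f) (a g)"]
      by (simp add: N_def)
    have ng: "0 \<le> hnorm H2 (a g)" using car by (simp add: H2.hnorm_nonneg)
    have "hnorm H2 (a g) * hnorm H2 (a g) \<le> N * hnorm H2 (a g)"
    proof -
      have "0 \<le> (hnorm H1 (f - g))\<^sup>2 / c\<^sup>2" by simp
      then show ?thesis using eq CS by (simp only: power2_eq_square)
    qed
    then have le: "hnorm H2 (a g) \<le> N"
      using ng N by (cases "hnorm H2 (a g) = 0") (auto simp: mult_le_cancel_right)
    have "(hnorm H1 (f - g))\<^sup>2 / c\<^sup>2 \<le> N * hnorm H2 (a g)"
      using eq CS by (smt (verit) zero_le_power2)
    also have "\<dots> \<le> N\<^sup>2" using le N by (simp add: power2_eq_square mult_left_mono)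
    finally have "(hnorm H1 (f - g))\<^sup>2 \<le> (c * N)\<^sup>2"
      using c by (simp add: field_simps power_mult_distrib)
    then have "hnorm H1 (f - g) \<le> c * N"
      by (rule power2_le_imp_le) (use c N in simp)
    then have d: "hnorm H1 f \<le> hnorm H1 g + c * N"
      using H1.hnorm_reverse_triangle[of f g] car by simp
    have "(sqrt \<epsilon> * hnorm H1 g)\<^sup>2 \<le> (hnorm H2 (a g))\<^sup>2"
      using bound_core[OF g] eps by (simp add: power_mult_distrib)
    then have "sqrt \<epsilon> * hnorm H1 g \<le> hnorm H2 (a g)"
      using ng by (rule power2_le_imp_le)
    moreover have "sqrt \<epsilon> * hnorm H1 f \<le> sqrt \<epsilon> * (hnorm H1 g + c * N)"
      using d eps by (intro mult_left_mono) auto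
    ultimately show ?thesis using le by (simp add: algebra_simps)
  qed
  note * = this
  show ?thesis
  proof (rule field_le_epsilon)
    fix e :: real assume e: "e > 0"
    \<comment> \<open>This \<open>c\<close> makes the error term at most \<open>e\<close>; the
      summand \<open>1\<close> covers \<open>N = 0\<close>.\<close>
    define c where "c = e / (sqrt \<epsilon> * N + 1)"
    have pos: "sqrt \<epsilon> * N \<ge> 0" using N eps by simp
    then have c: "c > 0" using e by (simp add: c_def)
    have "c * (sqrt \<epsilon> * N) \<le> c * (sqrt \<epsilon> * N + 1)" using c by simp
    also have "\<dots> = e" using pos by (simp add: c_def)
    finally show "sqrt \<epsilon> * hnorm H1 f \<le> hnorm H2 (a f) + e" using *[OF c] by (simp add: N_def)
  qed
qed

lemma a_eq_0_iff: "f \<in> dom A \<Longrightarrow> a f = 0 \<longleftrightarrow> f = 0"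
  using bound[of f] eps H1.hnorm_nonneg[of f] H1.hnorm_eq_0[of f]
  by (auto simp: dom_carrier mult_le_0_iff)

lemma a_inj: "f \<in> dom A \<Longrightarrow> f' \<in> dom A \<Longrightarrow> a f = a f' \<Longrightarrow> f = f'"
  using a_eq_0_iff[of "f - f'"] by (simp add: a_diff dom_diff)

text \<open>The resolvent with \<open>c = 1\<close> writes \<open>w = f + h\<close> with
  \<open>h = A' (a f)\<close>. Then \<open>ip H1 h w\<close> is the sum of the squared norms of
  \<open>h\<close> and \<open>a f\<close>, so both vanish, and injectivity of \<open>A\<close> gives
  \<open>f = 0\<close>.\<close>

lemma ran_AA_orth:
  assumes w: "w \<in> carrier H1"
    and orth: "\<And>f h. f \<in> dom A \<Longrightarrow> A' (a f) = Some h \<Longrightarrow> ip H1 h w = 0"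
  shows "w = 0"
proof -
  obtain f where f: "f \<in> dom A" "A' (a f) = Some (w - f)"
    using resolvent_exists[of 1 w] w by (auto simp: scaleC_one)
  note car = dom_carrier[OF f(1)] a_carrier[OF f(1)] w
  have "ip H1 (w - f) w = 0" by (rule orth[OF f])
  then have "ip H1 (w - f) (w - f) + ip H1 (w - f) f = 0"
    using car by (simp add: H1.ip_simps)
  moreover have "ip H1 (w - f) f = ip H2 (a f) (a f)"
    using A'D(4)[OF f(2,1)] by simp
  ultimately have "complex_of_real ((hnorm H1 (w - f))\<^sup>2 + (hnorm H2 (a f))\<^sup>2) = 0"
    using car by (simp add: H1.ip_self H2.ip_self)
  then have "(hnorm H1 (w - f))\<^sup>2 + (hnorm H2 (a f))\<^sup>2 = 0"
    by (simp only: of_real_eq_0_iff)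
  then have "hnorm H1 (w - f) = 0" "hnorm H2 (a f) = 0"
    by (simp_all add: sum_power2_eq_zero_iff)
  then show "w = 0"
    using car f(1) by (simp add: H1.hnorm_eq_0 H2.hnorm_eq_0 a_eq_0_iff)
qed

section \<open>The energy space and self-adjointness of
  \<open>\<i> *\<^sub>O GA0 H1 H2 A\<close>\<close>

lemma carrier_HA [simp]: "carrier (HA H2 A) = dom A"
  and ip_HA [simp]: "ip (HA H2 A) f g = ip H2 (a f) (a g)"
  by (simp_all add: HA_def)

lemma hnorm_HA: "hnorm (HA H2 A) f = hnorm H2 (a f)"
  by (simp add: hnorm_def)

text \<open>By the lower bound, the norm of \<open>HA\<close> is equivalent to the graph norm of
  \<open>A\<close>, and the graph of a closed operator between Hilbert spaces is complete.
  Definiteness is injectivity of \<open>A\<close>.\<close>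

lemma hilbert_HA: "hilbert (HA H2 A)"
proof
  show "inner_product_space (HA H2 A)"
    unfolding inner_product_space_def carrier_HA ip_HA
  proof (intro conjI ballI allI impI)
    show "complex_vector.subspace (dom A)" by (rule linear_opD(3)[OF linear])
    show "ip H2 (a g) (a f) = cnj (ip H2 (a f) (a g))" if "f \<in> dom A" "g \<in> dom A" for f g
      using that by (intro H2.ip_cnj a_carrier)
    show "0 < Re (ip H2 (a f) (a f))" if "f \<in> dom A" "f \<noteq> 0" for f
      using that by (intro H2.ip_pos a_carrier) (simp_all add: a_eq_0_iff)
  qed (simp_all add: a_add a_scale a_carrier H2.ip_simps)
next
  fix s assume s: "range s \<subseteq> carrier (HA H2 A)" and C: "hCauchy (HA H2 A) s"
  have sd: "s n \<in> dom A" for n using s by auto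
  have "hnorm (HA H2 A) (s m - s n) = hnorm H2 (a (s m) - a (s n))" for m n
    using sd by (simp add: hnorm_HA a_diff)
  then have "hCauchy H2 (\<lambda>n. a (s n))" using C by (simp add: hCauchy_def)
  then obtain y where y: "y \<in> carrier H2" "hconverges H2 (\<lambda>n. a (s n)) y"
    using H2.complete[of "\<lambda>n. a (s n)"] sd a_carrier by blast
  have "hCauchy H1 s" unfolding hCauchy_def
  proof (intro allI impI)
    fix e :: real assume e: "e > 0"
    then obtain N where N: "\<And>m n. m \<ge> N \<Longrightarrow> n \<ge> N \<Longrightarrow> hnorm (HA H2 A) (s m - s n) < sqrt \<epsilon> * e"
      using C eps unfolding hCauchy_def by (meson mult_pos_pos real_sqrt_gt_zero)
    have "hnorm H1 (s m - s n) < e" if "m \<ge> N" "n \<ge> N" for m n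
    proof -
      have "sqrt \<epsilon> * hnorm H1 (s m - s n) < sqrt \<epsilon> * e"
        using N[OF that] bound[of "s m - s n"] sd by (simp add: hnorm_HA dom_diff)
      then show ?thesis using eps by simp
    qed
    then show "\<exists>N. \<forall>m\<ge>N. \<forall>n\<ge>N. hnorm H1 (s m - s n) < e" by blast
  qed
  then obtain x where x: "x \<in> carrier H1" "hconverges H1 s x"
    using H1.complete[of s] sd dom_carrier by blast
  have Ax: "A x = Some y"
    using closed[unfolded closed_op_def, rule_format, of s x y] sd x y by auto
  then have xd: "x \<in> dom A" by (simp add: dom_def)
  have "hnorm (HA H2 A) (s n - x) = hnorm H2 (a (s n) - y)" for n
    using sd xd Ax by (simp add: hnorm_HA a_diff)
  then have "hconverges (HA H2 A) s x" using y by (simp add: hconverges_def)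
  then show "\<exists>x\<in>carrier (HA H2 A). hconverges (HA H2 A) s x" using xd by auto
qed

lemma hilbert_HA_H1: "hilbert (HA H2 A \<oplus>\<^sub>H H1)"
  using hilbert_HA by (rule hilbert_direct_sum) unfold_locales

lemma GA0_eq_Some:
  "GA0 H1 H2 A (f, g) = Some (p, q) \<longleftrightarrow> f \<in> dom A \<and> g \<in> dom A \<and> p = g \<and> A' (a f) = Some (- q)"
  unfolding GA0_def JA_def A_tilde_def block_op_eq_Some scale_op_eq_Some map_comp_Some_iff
  by (auto simp: dom_carrier A_eq_Some)

text \<open>The second component is solved for the value of \<open>A'\<close>, so that membership in
  the graph can be settled by the adjoint relation.\<close>

lemma iGA0_eq_Some:
  "(\<i> *\<^sub>O GA0 H1 H2 A) (f, g) = Some (p, q) \<longleftrightarrow>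
    f \<in> dom A \<and> g \<in> dom A \<and> p = \<i> *\<^sub>C g \<and> A' (a f) = Some (\<i> *\<^sub>C q)"
proof -
  have "q = \<i> *\<^sub>C q' \<longleftrightarrow> - q' = \<i> *\<^sub>C q" for q'
    by (auto simp: scaleC_scaleC scaleC_one)
      (metis complex_vector.scale_minus_left complex_vector.scale_minus_right i_squared mult_minus_left
        scaleC_one scaleC_scaleC minus_minus)
  then show ?thesis
    by (auto simp: scale_op_eq_Some GA0_eq_Some) (metis minus_minus)+
qed

theorem selfadjoint_iGA0: "selfadjoint (HA H2 A \<oplus>\<^sub>H H1) (\<i> *\<^sub>O GA0 H1 H2 A)"
proof -
  let ?K = "HA H2 A \<oplus>\<^sub>H H1" and ?T = "\<i> *\<^sub>O GA0 H1 H2 A"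
  interpret K: hilbert ?K by (rule hilbert_HA_H1)
  have hK: "hilbert_space ?K" unfolding hilbert_iff by (rule hilbert_HA_H1)
  have dT: "(f, g) \<in> dom ?T \<longleftrightarrow> f \<in> dom A \<and> g \<in> dom A \<and> a f \<in> dom A'" for f g
  proof
    assume "(f, g) \<in> dom ?T"
    then obtain p q where "?T (f, g) = Some (p, q)" by (auto simp: dom_def)
    then show "f \<in> dom A \<and> g \<in> dom A \<and> a f \<in> dom A'" unfolding iGA0_eq_Some by (auto simp: dom_def)
  next
    assume *: "f \<in> dom A \<and> g \<in> dom A \<and> a f \<in> dom A'"
    then obtain h where "A' (a f) = Some h" by (auto simp: dom_def)
    then have "?T (f, g) = Some (\<i> *\<^sub>C g, (- \<i>) *\<^sub>C h)"
      using * by (simp add: iGA0_eq_Some scaleC_scaleC scaleC_one)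
    then show "(f, g) \<in> dom ?T" by (simp add: dom_def)
  qed
  have lin: "linear_op ?K ?K ?T"
  proof (rule linear_opI[OF hK hK])
    show "x \<in> carrier ?K \<and> y \<in> carrier ?K" if "?T x = Some y" for x y
      using that A'D(2)[of _ "\<i> *\<^sub>C snd y"] H1.carrier_scale[of "\<i> *\<^sub>C snd y" "- \<i>"]
      by (cases x; cases y) (auto simp: iGA0_eq_Some dom_carrier dom_scale scaleC_scaleC scaleC_one)
    show "?T 0 = Some 0"
      by (simp add: zero_prod_def iGA0_eq_Some dom_zero A'_zero)
    show "?T (x + x') = Some (y + y')" if "?T x = Some y" "?T x' = Some y'" for x y x' y'
      using that by (cases x; cases y; cases x'; cases y')
        (auto simp: iGA0_eq_Some dom_add a_add complex_vector.scale_right_distrib intro: A'_add)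
    show "?T (c *\<^sub>C x) = Some (c *\<^sub>C y)" if "?T x = Some y" for x y c
      using that A'_scale[of "a (fst x)" "\<i> *\<^sub>C snd y" c]
      by (cases x; cases y) (auto simp: iGA0_eq_Some dom_scale a_scale scaleC_scaleC mult.commute)
  qed
  have dense: "densely_defined ?K ?T"
    unfolding densely_defined_def
  proof (rule K.dense_if_orth_trivial[OF linear_opD(3,4)[OF lin]])
    fix w assume w: "w \<in> carrier ?K" and orth: "\<And>z. z \<in> dom ?T \<Longrightarrow> ip ?K z w = 0"
    obtain w1 w2 where w12: "w = (w1, w2)" "w1 \<in> dom A" "w2 \<in> carrier H1" using w by auto
    \<comment> \<open>In the first component the product is that of \<open>HA\<close>; moving
      \<open>A\<close> across turns orthogonality there into orthogonality to
      \<open>ran (A\<^sup>* A)\<close> in \<open>H1\<close>.\<close>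
    have "w1 = 0"
    proof (rule ran_AA_orth)
      fix f h assume f: "f \<in> dom A" "A' (a f) = Some h"
      then have "(f, 0) \<in> dom ?T" by (auto simp: dT dom_zero intro: domI)
      from orth[OF this] have "ip H2 (a f) (a w1) = 0" using w12 by simp
      then show "ip H1 h w1 = 0" using A'D(4)[OF f(2) w12(2)] by simp
    qed (use w12 in \<open>simp add: dom_carrier\<close>)
    moreover have "w2 = 0"
    proof (rule H1.eq_zero_if_orth_dense[OF dense[unfolded densely_defined_def] w12(3)])
      fix g assume "g \<in> dom A"
      then have "(0, g) \<in> dom ?T" using A'_zero by (auto simp: dT dom_zero intro: domI)
      from orth[OF this] show "ip H1 g w2 = 0" using w12 by (simp add: a_carrier)
    qed
    ultimately show "w = 0" by (simp add: w12 zero_prod_def)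
  qed
  have "?T x = Some y" if adj: "adj_op ?K ?K ?T x = Some y" for x y
  proof -
    obtain p q p' q' where xy: "x = (p, q)" "y = (p', q')" by (metis prod.collapse)
    from adj have car: "p \<in> dom A" "q \<in> carrier H1" "p' \<in> dom A" "q' \<in> carrier H1"
      and eq: "\<And>z. z \<in> dom ?T \<Longrightarrow> ip ?K (the (?T z)) x = ip ?K z y"
      unfolding adj_op_iff[OF lin dense] by (auto simp: xy)
    have eq': "ip H2 (a (\<i> *\<^sub>C g)) (a p) + ip H1 ((- \<i>) *\<^sub>C h) q = ip H2 (a f) (a p') + ip H1 g q'"
      if "f \<in> dom A" "g \<in> dom A" "A' (a f) = Some h" for f g h
    proof -
      have "?T (f, g) = Some (\<i> *\<^sub>C g, (- \<i>) *\<^sub>C h)"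
        using that by (simp add: iGA0_eq_Some scaleC_scaleC scaleC_one)
      then show ?thesis using eq[of "(f, g)"] by (auto simp: xy dom_def)
    qed
    \<comment> \<open>Test vectors \<open>(0, g)\<close> isolate this component: the relation left
      over is the one that defines \<open>A'\<close> at \<open>a p\<close>.\<close>
    have "A' (a p) = Some (\<i> *\<^sub>C q')"
      unfolding A'_iff
    proof (intro conjI ballI)
      fix g assume g: "g \<in> dom A"
      have "(- \<i>) * ip H2 (a g) (a p) = ip H1 g q'"
        using eq'[OF dom_zero g, of 0] A'_zero g car
        by (simp add: a_scale a_carrier H2.ip_simps)
      then have "\<i> * ((- \<i>) * ip H2 (a g) (a p)) = \<i> * ip H1 g q'" by simp
      then show "ip H2 (a g) (a p) = ip H1 g (\<i> *\<^sub>C q')"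
        using g car by (simp add: H1.ip_scale_right dom_carrier)
    qed (use car in \<open>simp_all add: a_carrier\<close>)
    \<comment> \<open>Test vectors \<open>(f, 0)\<close> see \<open>q\<close> only through products
      with \<open>ran (A\<^sup>* A)\<close>. Since \<open>p'\<close> is known to be in
      \<open>dom A\<close>, the equation shows that \<open>q\<close> is in \<open>dom A\<close> as
      well.\<close>
    moreover have "q + \<i> *\<^sub>C p' = 0"
    proof (rule ran_AA_orth)
      fix f h assume f: "f \<in> dom A" "A' (a f) = Some h"
      have hc: "h \<in> carrier H1" using A'D(2)[OF f(2)] .
      have "\<i> * ip H1 h q = ip H1 h p'"
        using eq'[OF f(1) dom_zero f(2)] A'D(4)[OF f(2) car(3)] hc car
        by (simp add: a_carrier dom_carrier H1.ip_minus_left H1.ip_scale_left)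
      then have "ip H1 h p' = \<i> * ip H1 h q" by simp
      then show "ip H1 h (q + \<i> *\<^sub>C p') = 0"
        using hc car by (simp add: H1.ip_simps dom_carrier)
    qed (use car in \<open>simp add: dom_carrier\<close>)
    then have "q = (- \<i>) *\<^sub>C p'" by (simp add: eq_neg_iff_add_eq_0)
    then have "q \<in> dom A" "p' = \<i> *\<^sub>C q"
      using car by (simp_all add: dom_scale scaleC_scaleC scaleC_one del: complex_vector.scale_minus_left)
    ultimately show ?thesis using car by (simp add: xy iGA0_eq_Some)
  qed
  moreover have "adj_op ?K ?K ?T x = Some y" if T: "?T x = Some y" for x y
    unfolding adj_op_iff[OF lin dense]
  proof (intro conjI ballI)
    show "x \<in> carrier ?K" "y \<in> carrier ?K"
      using linear_opD(4,5)[OF lin] domI[of ?T x y, OF T] ranI[of ?T x y, OF T] by auto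
    obtain p q p' q' where xy: "x = (p, q)" "y = (p', q')" by (metis prod.collapse)
    have p: "p \<in> dom A" "q \<in> dom A" "p' = \<i> *\<^sub>C q" "A' (a p) = Some (\<i> *\<^sub>C q')"
      using T by (simp_all add: xy iGA0_eq_Some)
    have q'c: "q' \<in> carrier H1"
      using H1.carrier_scale[OF A'D(2)[OF p(4)], of "- \<i>"] by (simp add: scaleC_scaleC scaleC_one)
    fix z assume "z \<in> dom ?T"
    then obtain f g h k where z: "z = (f, g)" "?T (f, g) = Some (h, k)"
      by (metis domD prod.collapse)
    have f: "f \<in> dom A" "g \<in> dom A" "h = \<i> *\<^sub>C g" "A' (a f) = Some (\<i> *\<^sub>C k)"
      using z(2) by (simp_all add: iGA0_eq_Some)
    have kc: "k \<in> carrier H1"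
      using H1.carrier_scale[OF A'D(2)[OF f(4)], of "- \<i>"] by (simp add: scaleC_scaleC scaleC_one)
    \<comment> \<open>Symmetry amounts to these two instances of the adjoint relation, one for each
      off-diagonal block.\<close>
    have 1: "ip H2 (a g) (a p) = \<i> * ip H1 g q'"
      using A'D(3)[OF p(4) f(2)] f q'c by (simp add: H1.ip_scale_right dom_carrier)
    have 2: "ip H2 (a f) (a q) = - \<i> * ip H1 k q"
      using A'D(4)[OF f(4) p(2)] p kc by (simp add: H1.ip_scale_left dom_carrier)
    show "ip ?K (the (?T z)) x = ip ?K z y"
      using f p 1 2 by (simp add: z xy a_scale a_carrier H2.ip_simps)
  qed
  ultimately have "adj_op ?K ?K ?T = ?T" by (intro map_eqI) blast
  then show ?thesis using lin dense by (simp add: selfadjoint_def)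
qed

section \<open>Conjugation by the unitary \<open>U_tilde H1 H2 A\<close>\<close>

lemma QA0_eq_Some: "QA0 H1 H2 A (f, g) = Some (p, q) \<longleftrightarrow> A' g = Some p \<and> A f = Some q"
  unfolding QA0_def block_op_eq_Some
  using A'D(1) dom_carrier by (fastforce simp: dom_def)

lemma U_tilde_eq_Some: "U_tilde H1 H2 A (f, g) = Some (p, q) \<longleftrightarrow>
    f \<in> dom A \<and> g \<in> carrier H1 \<and> p = g \<and> q = (- \<i>) *\<^sub>C a f"
  unfolding U_tilde_def A_tilde_def block_op_eq_Some scale_op_eq_Some
  by (auto simp: A_eq_Some)

lemma inv_U_tilde_eq_Some:
  "inv_op (U_tilde H1 H2 A) y = Some x \<longleftrightarrow> U_tilde H1 H2 A x = Some y"
  unfolding inv_op_def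
proof (rule op_graph_iff)
  fix x x' assume "U_tilde H1 H2 A x = Some y" "U_tilde H1 H2 A x' = Some y"
  moreover have "f = f'" if "f \<in> dom A" "f' \<in> dom A" "(- \<i>) *\<^sub>C a f = (- \<i>) *\<^sub>C a f'" for f f'
    using that a_inj by simp
  ultimately show "x = x'"
    by (cases x; cases x'; cases y) (simp add: U_tilde_eq_Some)
qed

text \<open>Injectivity of \<open>A\<close> reduces the kernel of \<open>Q\<close> to the second
  component, where it is the kernel of \<open>A'\<close>, and \<open>ran A\<close> is orthogonal to
  that kernel. Hence the factor \<open>I - P\<close> acts as the identity on the space to which the
  left-hand side is restricted.\<close>

lemma orth_proj_ker_QA0:
  assumes f: "f \<in> carrier H1" and g: "g \<in> ran A"
  shows "orth_proj (H1 \<oplus>\<^sub>H H2) (ker_op (QA0 H1 H2 A)) (f, g) = Some 0"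
proof -
  interpret HH: ips "H1 \<oplus>\<^sub>H H2" by (rule ips_direct_sum) unfold_locales
  define R where "R x y \<longleftrightarrow> x \<in> carrier (H1 \<oplus>\<^sub>H H2) \<and> y \<in> ker_op (QA0 H1 H2 A) \<and>
    (\<forall>z\<in>ker_op (QA0 H1 H2 A). ip (H1 \<oplus>\<^sub>H H2) z (x - y) = 0)" for x y
  obtain k where k: "k \<in> dom A" "g = a k" using g by (auto simp: ran_def dom_def) force
  have gc: "g \<in> carrier H2" using k a_carrier by simp
  have ker: "z \<in> ker_op (QA0 H1 H2 A) \<longleftrightarrow> fst z = 0 \<and> A' (snd z) = Some 0" for z
    using QA0_eq_Some[of "fst z" "snd z" 0 0] a_eq_0_iff[of "fst z"] dom_zero
    by (auto simp: ker_op_def zero_prod_def A_eq_Some)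
  have orth: "ip (H1 \<oplus>\<^sub>H H2) z (f, g) = 0" if "z \<in> ker_op (QA0 H1 H2 A)" for z
    using that A'D(4)[of "snd z" 0 k] k f by (auto simp: ker dom_carrier)
  have kerc: "z \<in> carrier (H1 \<oplus>\<^sub>H H2)" if "z \<in> ker_op (QA0 H1 H2 A)" for z
    using that A'D(1)[of "snd z" 0] by (auto simp: ker mem_Times_iff)
  have R0: "R (f, g) 0"
    unfolding R_def using f gc orth A'_zero by (auto simp: ker zero_prod_def)
  \<comment> \<open>The projection is defined through a unique witness. A competing \<open>y\<close>
    in the kernel is orthogonal both to \<open>(f, g)\<close> and to \<open>(f, g) - y\<close>,
    hence to itself.\<close>
  have "\<exists>!y. R (f, g) y"
  proof
    fix y assume y: "R (f, g) y"
    then have yk: "y \<in> ker_op (QA0 H1 H2 A)" "ip (H1 \<oplus>\<^sub>H H2) y ((f, g) - y) = 0"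
      by (auto simp: R_def)
    have fg: "(f, g) \<in> carrier (H1 \<oplus>\<^sub>H H2)" using f gc by simp
    have "ip (H1 \<oplus>\<^sub>H H2) y y = 0"
      using yk(2) HH.ip_diff_right[OF kerc[OF yk(1)] fg kerc[OF yk(1)]] orth[OF yk(1)] by simp
    then show "y = 0" using HH.ip_pos[OF kerc[OF yk(1)]] by auto
  qed (rule R0)
  then have "op_graph R (f, g) = Some 0"
    using R0 by (simp add: op_graph_def the1_equality)
  then show ?thesis by (simp add: orth_proj_def R_def[abs_def])
qed

theorem QA0_eq_conjugate:
  "(QA0 H1 H2 A \<circ>\<^sub>m
      (id_op (carrier (H1 \<oplus>\<^sub>H H2)) -\<^sub>O orth_proj (H1 \<oplus>\<^sub>H H2) (ker_op (QA0 H1 H2 A))))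
     |` carrier (H1 \<oplus>\<^sub>H KA H2 A)
   = U_tilde H1 H2 A \<circ>\<^sub>m (\<i> *\<^sub>O GA0 H1 H2 A) \<circ>\<^sub>m inv_op (U_tilde H1 H2 A)"
  (is "?L = ?R")
proof (rule map_eqI)
  fix x y :: "'a \<times> 'b"
  obtain x1 x2 y1 y2 where xy: "x = (x1, x2)" "y = (y1, y2)" by (metis prod.collapse)
  have ranc: "g \<in> carrier H2" if "g \<in> ran A" for g
    using that linear_opD(5)[OF linear] by blast
  \<comment> \<open>This explicit graph is the common description of both sides, so that equality of
    domains is included.\<close>
  have "?L x = Some y \<longleftrightarrow> x1 \<in> dom A \<and> x2 \<in> ran A \<and> A' x2 = Some y1 \<and> y2 = a x1"
  proof (cases "x1 \<in> carrier H1 \<and> x2 \<in> ran A")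
    case True
    then have "(id_op (carrier (H1 \<oplus>\<^sub>H H2)) -\<^sub>O orth_proj (H1 \<oplus>\<^sub>H H2) (ker_op (QA0 H1 H2 A))) x = Some x"
      using orth_proj_ker_QA0[of x1 x2] ranc
      by (simp add: diff_op_def dom_def xy zero_prod_def id_op_def)
    then have "?L x = QA0 H1 H2 A (x1, x2)"
      using True by (simp add: restrict_map_def map_comp_def xy KA_def)
    then show ?thesis using True by (auto simp: xy QA0_eq_Some A_eq_Some)
  next
    case False
    then have "?L x = None" by (auto simp: restrict_map_def xy KA_def)
    then show ?thesis using False dom_carrier by auto
  qed
  also have "\<dots> \<longleftrightarrow> ?R x = Some y"
  proof
    assume *: "x1 \<in> dom A \<and> x2 \<in> ran A \<and> A' x2 = Some y1 \<and> y2 = a x1"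
    then obtain k where k: "k \<in> dom A" "x2 = a k" by (auto simp: ran_def dom_def) force
    \<comment> \<open>The factor \<open>- \<i>\<close> in \<open>U_tilde\<close> sends
      \<open>\<i> *\<^sub>C k\<close> to \<open>a k\<close>, so this is the preimage of
      \<open>(x1, a k)\<close>.\<close>
    have "inv_op (U_tilde H1 H2 A) x = Some (\<i> *\<^sub>C k, x1)"
      unfolding inv_U_tilde_eq_Some xy U_tilde_eq_Some
      using * k by (simp add: dom_scale dom_carrier a_scale scaleC_scaleC scaleC_one)
    moreover have "(\<i> *\<^sub>O GA0 H1 H2 A) (\<i> *\<^sub>C k, x1) = Some (\<i> *\<^sub>C x1, y1)"
      unfolding iGA0_eq_Some using * k by (simp add: dom_scale a_scale A'_scale)
    moreover have "U_tilde H1 H2 A (\<i> *\<^sub>C x1, y1) = Some y"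
      unfolding xy U_tilde_eq_Some using * A'D(2)[of x2 y1]
      by (simp add: dom_scale a_scale scaleC_scaleC scaleC_one)
    ultimately show "?R x = Some y" by (simp add: map_comp_def)
  next
    assume "?R x = Some y"
    then obtain f g p q where fg: "U_tilde H1 H2 A (f, g) = Some x"
        "(\<i> *\<^sub>O GA0 H1 H2 A) (f, g) = Some (p, q)" "U_tilde H1 H2 A (p, q) = Some y"
      unfolding map_comp_Some_iff inv_U_tilde_eq_Some by auto
    then have f: "f \<in> dom A" "x1 \<in> dom A" "x2 = (- \<i>) *\<^sub>C a f" "A' (a f) = Some (\<i> *\<^sub>C y1)"
      "y2 = (- \<i>) *\<^sub>C a (\<i> *\<^sub>C x1)"
      unfolding xy U_tilde_eq_Some iGA0_eq_Some by auto
    have "A' x2 = Some y1"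
      using A'_scale[OF f(4), of "- \<i>"] by (simp add: f(3) scaleC_scaleC scaleC_one)
    moreover have "x2 = a ((- \<i>) *\<^sub>C f)" using a_scale[OF f(1), of "- \<i>"] f(3) by simp
    then have "x2 \<in> ran A" using dom_scale[OF f(1)] A_eq_Some by (metis ranI)
    moreover have "y2 = a x1" using f by (simp add: a_scale scaleC_scaleC scaleC_one)
    ultimately show "x1 \<in> dom A \<and> x2 \<in> ran A \<and> A' x2 = Some y1 \<and> y2 = a x1"
      using f(2) by blast
  qed
  finally show "?L x = Some y \<longleftrightarrow> ?R x = Some y" .
qed

theorem GA0_equivalent_uminus:
  "unitarily_equivalent (HA H2 A \<oplus>\<^sub>H H1) (GA0 H1 H2 A) (HA H2 A \<oplus>\<^sub>H H1) ((- 1) *\<^sub>O GA0 H1 H2 A)"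
  unfolding unitarily_equivalent_def
proof (intro exI conjI)
  let ?K = "HA H2 A \<oplus>\<^sub>H H1"
  interpret K: hilbert ?K by (rule hilbert_HA_H1)
  have hK: "hilbert_space ?K" unfolding hilbert_iff by (rule hilbert_HA_H1)
  define V where "V p = (if p \<in> carrier ?K then Some (fst p, - snd p) else None)" for p
  have V: "V (f, g) = Some (p, q) \<longleftrightarrow> f \<in> dom A \<and> g \<in> carrier H1 \<and> p = f \<and> q = - g" for f g p q
    by (auto simp: V_def)
  \<comment> \<open>\<open>V\<close> is an involution; its graph is symmetric, so it is its own
    inverse and its range is its domain.\<close>
  have V_sym: "V y = Some x \<longleftrightarrow> V x = Some y" for x y
    using H1.carrier_minus by (cases x; cases y) (auto simp: V)
  have inv: "inv_op V = V" unfolding inv_op_def by (rule op_graph_eqI) (rule V_sym)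
  have dom_V: "dom V = carrier ?K" by (auto simp: V_def dom_def split: if_splits)
  have ran_V: "ran V = carrier ?K"
    unfolding dom_V[symmetric] using V_sym by (auto simp: ran_def dom_def)
  show "unitary ?K ?K V"
    unfolding unitary_def
  proof (intro conjI ballI)
    show "linear_op ?K ?K V"
    proof (rule linear_opI[OF hK hK])
      show "x \<in> carrier ?K \<and> y \<in> carrier ?K" if "V x = Some y" for x y
        using that dom_V ran_V by (metis domI ranI)
    qed (auto simp: V_def zero_prod_def scaleC_prod_def dom_zero dom_add dom_scale split: if_splits)
    show "ip ?K (the (V x)) (the (V y)) = ip ?K x y" if "x \<in> carrier ?K" "y \<in> carrier ?K" for x y
      using that by (auto simp: V_def H1.ip_simps)
  qed (rule dom_V ran_V)+
  show "(- 1) *\<^sub>O GA0 H1 H2 A = V \<circ>\<^sub>m GA0 H1 H2 A \<circ>\<^sub>m inv_op V"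
    unfolding inv
  proof (rule map_eqI)
    fix x y :: "'a \<times> 'a"
    obtain f g p q where xy: "x = (f, g)" "y = (p, q)" by (metis prod.collapse)
    have "((- 1) *\<^sub>O GA0 H1 H2 A) x = Some y \<longleftrightarrow>
        f \<in> dom A \<and> g \<in> dom A \<and> p = - g \<and> A' (a f) = Some q"
      unfolding scale_op_eq_Some xy by (auto simp: GA0_eq_Some) (metis minus_minus)
    also have "\<dots> \<longleftrightarrow> (V \<circ>\<^sub>m GA0 H1 H2 A \<circ>\<^sub>m V) x = Some y"
    proof
      assume *: "f \<in> dom A \<and> g \<in> dom A \<and> p = - g \<and> A' (a f) = Some q"
      then have "- g \<in> dom A" using dom_scale[of g "-1"] by simp
      then have "V x = Some (f, - g)" "GA0 H1 H2 A (f, - g) = Some (- g, - q)"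
          "V (- g, - q) = Some y"
        using * A'D(2)[of "a f" q] by (simp_all add: xy V dom_carrier GA0_eq_Some)
      then show "(V \<circ>\<^sub>m GA0 H1 H2 A \<circ>\<^sub>m V) x = Some y" by (simp add: map_comp_def)
    next
      assume "(V \<circ>\<^sub>m GA0 H1 H2 A \<circ>\<^sub>m V) x = Some y"
      then obtain f' g' p' q' where *: "V (f, g) = Some (f', g')"
          "GA0 H1 H2 A (f', g') = Some (p', q')" "V (p', q') = Some (p, q)"
        unfolding map_comp_Some_iff xy by auto
      then have **: "f \<in> dom A" "- g \<in> dom A" "p = - g" "A' (a f) = Some q"
        unfolding V GA0_eq_Some by auto
      then have "g \<in> dom A" using dom_scale[of "- g" "-1"] by simp
      then show "f \<in> dom A \<and> g \<in> dom A \<and> p = - g \<and> A' (a f) = Some q" using ** by blast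
    qed
    finally show "((- 1) *\<^sub>O GA0 H1 H2 A) x = Some y \<longleftrightarrow> (V \<circ>\<^sub>m GA0 H1 H2 A \<circ>\<^sub>m V) x = Some y" .
  qed
qed

end

theorem theorem2p8:
  fixes H1 :: "'a::complex_vector hspace" and H2 :: "'b::complex_vector hspace"
    and A :: "'a \<rightharpoonup> 'b" and \<epsilon> :: real
  assumes "hilbert_space H1" and "separable_hspace H1"
    and "hilbert_space H2" and "separable_hspace H2"
    and "linear_op H1 H2 A" and "densely_defined H1 A" and "closed_op H1 H2 A"
    and "\<epsilon> > 0" and "op_ge H1 (adj_op H1 H2 A \<circ>\<^sub>m A) \<epsilon>"
  shows "(QA0 H1 H2 A \<circ>\<^sub>m
            (id_op (carrier (H1 \<oplus>\<^sub>H H2)) -\<^sub>O orth_proj (H1 \<oplus>\<^sub>H H2) (ker_op (QA0 H1 H2 A))))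
           |` carrier (H1 \<oplus>\<^sub>H KA H2 A)
         = U_tilde H1 H2 A \<circ>\<^sub>m (\<i> *\<^sub>O GA0 H1 H2 A) \<circ>\<^sub>m inv_op (U_tilde H1 H2 A)
       \<and> selfadjoint (HA H2 A \<oplus>\<^sub>H H1) (\<i> *\<^sub>O GA0 H1 H2 A)
       \<and> generates_unitary_group (HA H2 A \<oplus>\<^sub>H H1) (GA0 H1 H2 A)
       \<and> unitarily_equivalent (HA H2 A \<oplus>\<^sub>H H1) (GA0 H1 H2 A)
           (HA H2 A \<oplus>\<^sub>H H1) ((- 1) *\<^sub>O GA0 H1 H2 A)"
proof -
  interpret bounded_below_op H1 H2 A \<epsilon>
    using assms(5-9) by unfold_locales
  show ?thesis
    using QA0_eq_conjugate selfadjoint_iGA0 selfadjoint_generates_unitary_group[OF selfadjoint_iGA0] GA0_equivalent_uminus by blast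
qed

end
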